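(* Consider the Clipped FedSMD algorithm described in the context under Assumptions (A1)–(A3). Fix $\delta\in(0,1)$, $p\in(1,2]$ and $\sigma$ from (A1), parameters $0<\kappa<1$, $0<\mu<1$ with $\kappa\ge\max\{\mu+\frac12,\,1-\mu(p-1)\}$, and $\gamma>1$. Let $A>0$ and let the stepsizes and clipping parameters be $$\alpha_t=\frac{1}{(1+\log t)^\gamma t^{\kappa-\mu}}\min\Big\{\frac1{t^\mu},\big[2mL(2R_1+10A)+2B\big]^{-1}\Big\},\qquad\lambda_t=\max\big\{t^\mu,\,2mL(2R_1+10A)+2B\big\},$$ where $A$ takes the form $$A=\log\frac1\delta+mL\mathcal P^2C_0+2m\mathcal PC_1+4\sigma^pC_2+16m\sigma^{2p}C_3+40m\sigma^p(1+3m)C_4+40m^2\sigma^pC_5+8m,$$ with the (finite) constants $C_0=\sum_{t=1}^\infty\alpha_t\alpha_{\tau(t)}^2\lambda_{\tau(t)}^2$, $C_1=\sum_{t=1}^\infty\alpha_t\alpha_{\tau(t)}\lambda_t\lambda_{\tau(t)}$, $C_2=\sum_{t=1}^\infty\alpha_t\lambda_t^{1-p}$, $C_3=\sum_{t=1}^\infty\alpha_t^2\lambda_t^{2-2p}$, $C_4=\sum_{t=1}^\infty(\alpha_t\lambda_t)^2\lambda_t^{-p}$, $C_5=\sum_{t=1}^\infty(\alpha_t\lambda_t)^4\lambda_t^{-p}$. Suppose the event $E(\delta)$ (defined in the context, with this $A$) happens. If for some $K\in[T]$ it holds that $\|\nabla f_i(x_{i,t})\|\le\lambda_t/2$ for all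 $i\in[m]$ and $1\le t\le K-1$, then for any $\ell\in[m]$ and $1\le S\le K$, $$\sum_{t=1}^S\alpha_t\big[f(x_{\ell,t})-f(x^* )\big]+\sum_{i=1}^mD_\Phi(x^*\|x_{i,S+1})\le m^2(R_1+10A)^2 .$$
   Context: Setting: $m,n\in\mathbb N$, $\|\cdot\|$ Euclidean norm on $\mathbb R^n$, $\mathcal X\subset\mathbb R^n$ nonempty closed convex, $f_i:\mathcal X\to\mathbb R$ convex differentiable ($i\in[m]$), $f=\sum_if_i$, $x^*\in\mathcal X$ a minimizer of $f$. $\Phi:\mathcal X\to\mathbb R$ differentiable, $1$-strongly convex ($\Phi(x)-\Phi(y)\ge\langle\nabla\Phi(y),x-y\rangle+\frac12\|x-y\|^2$), $D_\Phi(x\|y)=\Phi(x)-\Phi(y)-\langle\nabla\Phi(y),x-y\rangle$. Agent $i$ queried at $x$ receives a random $\widehat\nabla f_i(x)$; $\widetilde\nabla_\lambda f_i(x)=\min\{1,\lambda/\|\widehat\nabla f_i(x)\|\}\widehat\nabla f_i(x)$. Clipped FedSMD: communication period $\mathcal P\in\mathbb N$, rounds $\mathcal T$, $\mathcal I=\{1+k\mathcal P:k=1,\dots,\mathcal T\}$, $T=1+\mathcal T\mathcal P$. From $x_{i,1}\in\mathcal X$, for $t=1,\dots,T$, each agent $i$ sets $y_{i,t+1}=\arg\min_{x\in\mathcal X}\{\langle\widetilde\nabla_{\lambda_t}f_i(x_{i,t}),x\rangle+\frac1{\alpha_t}D_\Phi(x\|x_{i,t})\}$, and $x_{i,t+1}=\frac1m\sum_jy_{j,t+1}$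 if $t+1\in\mathcal I$, else $x_{i,t+1}=y_{i,t+1}$. $\tau(t)=\max\{1+k\mathcal P:k\ge1,\,1+k\mathcal P\le t\}$ if $t>1+\mathcal P$, and $\tau(t)=1$ if $1\le t\le1+\mathcal P$ (defined for all $t\ge1$). $\mathcal F_t$ is the $\sigma$-algebra generated by $\{\widehat\nabla f_i(x_{i,s}):i\in[m],s\le t\}$, $\mathcal F_0$ trivial; $\theta^u_{i,t}=\widetilde\nabla_{\lambda_t}f_i(x_{i,t})-\mathbb E[\widetilde\nabla_{\lambda_t}f_i(x_{i,t})\mid\mathcal F_{t-1}]$, $\theta^b_{i,t}=\mathbb E[\widetilde\nabla_{\lambda_t}f_i(x_{i,t})\mid\mathcal F_{t-1}]-\nabla f_i(x_{i,t})$. Assumptions: (A1) $\mathbb E[\widehat\nabla f_i(x_{i,t})\mid\mathcal F_{t-1}]=\nabla f_i(x_{i,t})$ and $\mathbb E[\|\widehat\nabla f_i(x_{i,t})-\nabla f_i(x_{i,t})\|^p\mid\mathcal F_{t-1}]\le\sigma^p$, $\sigma>0$, $p\in(1,2]$; (A2) $\|\nabla f_i(x)-\nabla f_i(y)\|\le L\|x-y\|$ on $\mathcal X$; (A3) $D_\Phi(x\|\sum_ja_jy_j)\le\sum_ja_jD_\Phi(x\|y_j)$ for all $x,y_j\in\mathcal X$, $a_j\ge0$, $\sum_ja_j=1$. Problem parameters: $R_1=\max_{i\in[m]}\sqrt{2D_\Phi(x^*\|x_{i,1})}$ (or any known upper bound of it), $B=\max_{i\in[m]}\|\nabla f_i(x_{i,1})\|$.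 Event $E(\delta)$: with $V_t=2m\max_{i\in[m],1\le s\le t}\sqrt{2D_\Phi(x^*\|x_{i,s})}+A$, the event that for all $\ell\in[m]$ and all $S\in[T]$: $\sum_{t=1}^S\frac{\alpha_t}{V_t}[f(x_{\ell,t})-f(x^* )]+\frac1{V_S}\sum_iD_\Phi(x^*\|x_{i,S+1})\le\log\frac1\delta+\frac1{V_1}\sum_iD_\Phi(x^*\|x_{i,1})+\sum_{t=1}^S\frac{\alpha_t}{V_t}\sum_iL\|x_{\ell,t}-x_{i,t}\|^2+\sum_{t=1}^S\frac{\alpha_t}{V_t}\sum_i\|\nabla f_i(x_{i,t})\|\|x_{i,t}-x_{\ell,t}\|+\sum_{t=1}^S\frac{\alpha_t}{V_t}\sum_i\langle\theta^b_{i,t},x^*-x_{i,t}\rangle+\sum_{t=1}^S\frac{\alpha_t^2}{V_t}\sum_i\|\theta^b_{i,t}\|^2+\sum_{t=1}^S\big(\frac{\alpha_t^2}{V_t}+3m\alpha_t^2+\frac{6\alpha_t^4\lambda_t^2m}{V_t^2}\big)\sum_i\mathbb E[\|\theta^u_{i,t}\|^2\mid\mathcal F_{t-1}]$. *)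

theory Defs
  imports "HOL-Analysis.Analysis" "HOL-Probability.Probability"
begin

definition bregman :: "(real^'n \<Rightarrow> real) \<Rightarrow> (real^'n \<Rightarrow> real^'n) \<Rightarrow> real^'n \<Rightarrow> real^'n \<Rightarrow> real" where
  "bregman Phi gPhi x y = Phi x - Phi y - gPhi y \<bullet> (x - y)"

text \<open>Clipping: min{1, lam/||g||} g  (for g = 0 the result is 0, as it should be).\<close>
definition clip :: "real \<Rightarrow> real^'n \<Rightarrow> real^'n" where
  "clip lam g = min 1 (lam / norm g) *\<^sub>R g"

definition comm_times :: "nat \<Rightarrow> nat \<Rightarrow> nat set" where
  "comm_times P Tc = {1 + k * P | k. 1 \<le> k \<and> k \<le> Tc}"

definition tau :: "nat \<Rightarrow> nat \<Rightarrow> nat" where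
  "tau P t = (if t \<le> 1 + P then 1 else Max {1 + k * P | k. 1 \<le> k \<and> 1 + k * P \<le> t})"

definition filt :: "'a measure \<Rightarrow> (nat \<Rightarrow> nat \<Rightarrow> 'a \<Rightarrow> real^'n) \<Rightarrow> nat \<Rightarrow> nat \<Rightarrow> 'a measure" where
  "filt M G m t = sigma (space M)
     {G i s -` B \<inter> space M | i s B. i \<in> {1..m} \<and> s \<in> {1..t} \<and> B \<in> sets borel}"

definition vcond_exp :: "'a measure \<Rightarrow> 'a measure \<Rightarrow> ('a \<Rightarrow> real^'n) \<Rightarrow> 'a \<Rightarrow> real^'n" where
  "vcond_exp M F X \<omega> = (\<chi> j. real_cond_exp M F (\<lambda>\<eta>. X \<eta> $ j) \<omega>)"

definition theta_u where
  "theta_u M G m lam i t \<omega> =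
     clip (lam t) (G i t \<omega>) - vcond_exp M (filt M G m (t - 1)) (\<lambda>\<eta>. clip (lam t) (G i t \<eta>)) \<omega>"

definition theta_b where
  "theta_b M G m lam gf x i t \<omega> =
     vcond_exp M (filt M G m (t - 1)) (\<lambda>\<eta>. clip (lam t) (G i t \<eta>)) \<omega> - gf i (x i t \<omega>)"

definition Vt where
  "Vt Phi gPhi x xstar m A t \<omega> =
     2 * real m * Max {sqrt (2 * bregman Phi gPhi xstar (x i s \<omega>)) | i s. i \<in> {1..m} \<and> s \<in> {1..t}} + A"

definition event_E where
  "event_E M G Phi gPhi f gf x xstar m T L alpha lam A \<delta> \<omega> \<longleftrightarrow>
    (\<forall>l \<in> {1..m}. \<forall>S \<in> {1..T}.
      (let V = (\<lambda>t. Vt Phi gPhi x xstar m A t \<omega>);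
           F = (\<lambda>z. \<Sum>i=1..m. f i z) in
      (\<Sum>t=1..S. alpha t / V t * (F (x l t \<omega>) - F xstar))
        + 1 / V S * (\<Sum>i=1..m. bregman Phi gPhi xstar (x i (S + 1) \<omega>))
      \<le> ln (1 / \<delta>)
        + 1 / V 1 * (\<Sum>i=1..m. bregman Phi gPhi xstar (x i 1 \<omega>))
        + (\<Sum>t=1..S. alpha t / V t * (\<Sum>i=1..m. L * (norm (x l t \<omega> - x i t \<omega>))\<^sup>2))
        + (\<Sum>t=1..S. alpha t / V t * (\<Sum>i=1..m. norm (gf i (x i t \<omega>)) * norm (x i t \<omega> - x l t \<omega>)))
        + (\<Sum>t=1..S. alpha t / V t * (\<Sum>i=1..m. theta_b M G m lam gf x i t \<omega> \<bullet> (xstar - x i t \<omega>)))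
        + (\<Sum>t=1..S. (alpha t)\<^sup>2 / V t * (\<Sum>i=1..m. (norm (theta_b M G m lam gf x i t \<omega>))\<^sup>2))
        + (\<Sum>t=1..S. ((alpha t)\<^sup>2 / V t + 3 * real m * (alpha t)\<^sup>2
                        + 6 * (alpha t)^4 * (lam t)\<^sup>2 * real m / (V t)\<^sup>2)
             * (\<Sum>i=1..m. real_cond_exp M (filt M G m (t - 1))
                   (\<lambda>\<eta>. (norm (theta_u M G m lam i t \<eta>))\<^sup>2) \<omega>))))"

end

theory Submission
  imports Defs
begin

text \<open>
  Put \<open>\<rho> = m (R\<^sub>1 + 10 A)\<close> and suppose that the radii \<open>sqrt (2 D)\<close> of all agents are at most \<open>\<rho>\<close> up to
  time \<open>S\<close>. By smoothness every gradient is then at most \<open>\<lambda>\<^sub>t / 2\<close>, hence clipping causes a bias of order \<open>\<sigma>\<^sup>p \<lambda>\<^sub>t\<^bsup>1-p\<^esup>\<close> and a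
  conditional variance of order \<open>\<sigma>\<^sup>p \<lambda>\<^sub>t\<^bsup>2-p\<^esup>\<close>, while after a communication the agents drift apart by at
  most \<open>4 P \<alpha>\<^sub>\<tau> \<lambda>\<^sub>\<tau>\<close>. The normalisation \<open>V\<^sub>t\<close> absorbs all distances to the minimizer, and the choice of \<open>A\<close>
  makes the right-hand side of the event at most \<open>R\<^sub>1 / 4 + 2 A\<close>. Multiplying by \<open>V\<^sub>S \<le> 2 m \<rho> + A\<close> gives
  the bound \<open>\<rho>\<^sup>2 / 2\<close>, which reproduces the induction hypothesis at \<open>S + 1\<close>.
\<close>

subsection \<open>Clipping and conditional expectations\<close>

text \<open>Two circularities shape the proof. The moment bounds on clipping need
  \<open>norm (gf i (x i t \<omega>)) \<le> lam t / 2\<close>, but this gradient is random and is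
  controlled only along the induction. Hence the bounds are proved as implications at almost every
  sample point: the condition is measurable with respect to the past, so its indicator passes
  through the conditional expectation. Only finitely many pairs of agent and time occur, so one null
  set serves for all, and off it the induction is deterministic. Secondly, \<open>A\<close> occurs
  on both sides of its defining equation, through \<open>alpha\<close> and \<open>lam\<close>. The
  equation is taken as given; what matters is that its series converge for every threshold
  \<open>Q \<ge> 0\<close>, so that they dominate the finite sums in the event.\<close>

lemma norm_clip_le:
  assumes "0 \<le> lam"
  shows "norm (clip lam g) \<le> lam"
proof (cases "g = 0")
  case False
  have "min 1 (lam / norm g) * norm g \<le> lam / norm g * norm g"
    by (intro mult_right_mono) auto
  then show ?thesis using False assms by (simp add: clip_def)
qed (simp add: clip_def assms)

lemma clip_eq_self:
  assumes "norm g \<le> lam"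
  shows "clip lam g = g"
proof (cases "g = 0")
  case False
  then have "1 \<le> lam / norm g" using assms by (simp add: field_simps)
  then show ?thesis by (simp add: clip_def)
qed (simp add: clip_def)

lemma norm_clip_diff:
  assumes "0 \<le> lam" "lam \<le> norm g"
  shows "norm (clip lam g - g) = norm g - lam"
proof (cases "g = 0")
  case False
  then have "lam / norm g \<le> 1" using assms by (simp add: field_simps)
  then have "clip lam g - g = - ((1 - lam / norm g) *\<^sub>R g)"
    by (simp add: clip_def algebra_simps)
  then have "norm (clip lam g - g) = \<bar>1 - lam / norm g\<bar> * norm g"
    by (simp only: norm_minus_cancel norm_scaleR)
  also have "\<dots> = norm g - lam / norm g * norm g"
    using \<open>lam / norm g \<le> 1\<close> by (simp add: algebra_simps)
  finally show ?thesis using False by simp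
qed (use assms in \<open>simp add: clip_def\<close>)

lemma powr_ratio_le:
  fixes a c q :: real
  assumes "0 < c" "c / 2 \<le> a" "0 \<le> q" "q \<le> 2"
  shows "c powr q \<le> 4 * a powr q"
proof -
  have "c powr q \<le> (2 * a) powr q" using assms by (intro powr_mono2) auto
  also have "\<dots> = 2 powr q * a powr q" using assms by (simp add: powr_mult)
  also have "\<dots> \<le> 2 powr 2 * a powr q" using assms by (intro mult_right_mono powr_mono) auto
  finally show ?thesis by simp
qed

text \<open>Clipping acts only if \<open>norm v > lam\<close>, which forces
  \<open>d = norm (v - g) \<ge> lam / 2\<close>. Then the excess is at most \<open>d\<close>, and
  \<open>d \<le> lam^(1-p) (2 d)^(p-1) d\<close> as in Markov's inequality; the constant is
  \<open>2^(p-1) \<le> 2\<close>.\<close>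

lemma norm_clip_diff_le_powr:
  fixes g v :: "real^'n"
  assumes "0 < lam" "norm g \<le> lam / 2" "1 < p" "p \<le> 2"
  shows "norm (clip lam v - v) \<le> 2 * lam powr (1 - p) * norm (v - g) powr p"
proof (cases "norm v \<le> lam")
  case True
  then show ?thesis by (simp add: clip_eq_self)
next
  case False
  define d where "d = norm (v - g)"
  have d: "norm v \<le> d + norm g" unfolding d_def by (metis add.commute norm_triangle_sub)
  then have dl: "lam / 2 \<le> d" using False assms by linarith
  have "lam powr (p - 1) \<le> (2 * d) powr (p - 1)" using dl assms by (intro powr_mono2) auto
  also have "\<dots> = 2 powr (p - 1) * d powr (p - 1)" using dl assms by (simp add: powr_mult)
  also have "\<dots> \<le> 2 powr 1 * d powr (p - 1)" using assms by (intro mult_right_mono powr_mono) auto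
  finally have *: "lam powr (p - 1) \<le> 2 * d powr (p - 1)" by simp
  have "norm (clip lam v - v) = norm v - lam" using False assms by (intro norm_clip_diff) auto
  also have "\<dots> \<le> d" using d assms by linarith
  also have "\<dots> = lam powr (1 - p) * lam powr (p - 1) * d"
    using assms by (simp add: powr_add[symmetric])
  also have "\<dots> \<le> lam powr (1 - p) * (2 * d powr (p - 1)) * d"
    using * dl assms by (intro mult_right_mono mult_left_mono) auto
  also have "\<dots> = 2 * lam powr (1 - p) * d powr p"
    using dl assms powr_add[of d "p - 1" 1] by simp
  finally show ?thesis by (simp add: d_def)
qed

text \<open>Unclipped, \<open>d \<le> 2 lam\<close> lets \<open>d^2 = d^(2-p) d^p\<close> trade
  \<open>2 - p\<close> powers of \<open>d\<close> for powers of \<open>lam\<close>. Clipped, the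
  deviation is at most \<open>3/2 lam\<close> and \<open>lam^p \<le> 4 d^p\<close>; this case gives
  the constant \<open>9 = 9/4 * 4\<close>.\<close>

lemma norm_clip_dev_le_powr:
  fixes g v :: "real^'n"
  assumes "0 < lam" "norm g \<le> lam / 2" "1 < p" "p \<le> 2"
  shows "(norm (clip lam v - g))\<^sup>2 \<le> 9 * lam powr (2 - p) * norm (v - g) powr p"
proof -
  define d where "d = norm (v - g)"
  have dnn: "0 \<le> d" unfolding d_def by simp
  have sq: "lam powr (2 - p) * lam powr p = lam\<^sup>2"
    using assms by (simp add: powr_add[symmetric] powr_numeral)
  show ?thesis
  proof (cases "norm v \<le> lam")
    case True
    have "d \<le> norm v + norm g" unfolding d_def by (rule norm_triangle_ineq4)
    then have dl: "d \<le> 2 * lam" using True assms by linarith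
    have "d\<^sup>2 = d powr (2 - p) * d powr p"
      using dnn by (cases "d = 0") (auto simp: powr_add[symmetric] powr_numeral)
    also have "\<dots> \<le> (2 * lam) powr (2 - p) * d powr p"
      using dl dnn assms by (intro mult_right_mono powr_mono2) auto
    also have "\<dots> = 2 powr (2 - p) * lam powr (2 - p) * d powr p"
      using assms by (simp add: powr_mult)
    also have "\<dots> \<le> 2 powr 1 * lam powr (2 - p) * d powr p"
      using assms by (intro mult_right_mono powr_mono) auto
    also have "\<dots> \<le> 9 * lam powr (2 - p) * d powr p"
      by (intro mult_right_mono) auto
    finally show ?thesis using True by (simp add: d_def clip_eq_self)
  next
    case False
    have "norm v \<le> d + norm g" unfolding d_def by (metis add.commute norm_triangle_sub)
    then have dl: "lam / 2 \<le> d" using False assms by linarith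
    have "norm (clip lam v - g) \<le> norm (clip lam v) + norm g" by (rule norm_triangle_ineq4)
    also have "\<dots> \<le> 3 / 2 * lam" using norm_clip_le[of lam v] assms by linarith
    finally have "(norm (clip lam v - g))\<^sup>2 \<le> (3 / 2 * lam)\<^sup>2" by (intro power_mono) auto
    also have "\<dots> = 9 / 4 * (lam powr (2 - p) * lam powr p)"
      unfolding sq by (simp add: power2_eq_square)
    also have "\<dots> \<le> 9 / 4 * (lam powr (2 - p) * (4 * d powr p))"
      using powr_ratio_le[OF assms(1) dl, of p] assms by (intro mult_left_mono) auto
    finally show ?thesis by (simp add: d_def mult_ac)
  qed
qed

section \<open>Measurability and conditional expectation of clipped vectors\<close>

lemma clip_measurable [measurable]: "clip lam \<in> borel_measurable borel"
  unfolding clip_def by measurable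

lemma vcond_exp_nth: "vcond_exp M F X \<omega> $ j = real_cond_exp M F (\<lambda>\<eta>. X \<eta> $ j) \<omega>"
  by (simp add: vcond_exp_def)

lemma vcond_exp_measurable [measurable]: "vcond_exp M F X \<in> borel_measurable F"
  by (subst borel_measurable_euclidean_space)
     (auto simp: vcond_exp_nth Basis_vec_def inner_axis)

lemma integrable_vec:
  fixes Z :: "'a \<Rightarrow> real^'n"
  assumes "\<And>j. integrable M (\<lambda>\<omega>. Z \<omega> $ j)"
  shows "integrable M Z"
proof -
  have "integrable M (\<lambda>\<omega>. \<Sum>j\<in>UNIV. Z \<omega> $ j *\<^sub>R axis j (1::real))"
    by (intro Bochner_Integration.integrable_sum integrable_scaleR_left assms)
  moreover have "(\<lambda>\<omega>. \<Sum>j\<in>UNIV. Z \<omega> $ j *\<^sub>R axis j (1::real)) = Z"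
    by (auto simp: vec_eq_iff axis_def if_distrib cong: if_cong)
  ultimately show ?thesis by (simp only:)
qed

context sigma_finite_subalgebra
begin

text \<open>The direction of the conditional expectation is itself \<open>F\<close>-measurable, so it can be moved inside.\<close>
lemma norm_vcond_exp_le:
  fixes Z :: "'a \<Rightarrow> real^'n"
  assumes Z: "integrable M Z"
  shows "AE \<omega> in M. norm (vcond_exp M F Z \<omega>) \<le> real_cond_exp M F (\<lambda>\<eta>. norm (Z \<eta>)) \<omega>"
proof -
  have [measurable]: "Z \<in> borel_measurable M" using Z by simp
  define U where "U = vcond_exp M F Z"
  have [measurable]: "U \<in> borel_measurable F" unfolding U_def by simp
  have [measurable]: "U \<in> borel_measurable M" by (rule measurable_from_subalg[OF subalg]) simp
  define h where "h = (\<lambda>\<omega>. sgn (U \<omega>))"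
  have hF: "(\<lambda>\<omega>. h \<omega> $ j) \<in> borel_measurable F" for j
  proof -
    have "(\<lambda>\<omega>. U \<omega> $ j) \<in> borel_measurable F"
      by (rule measurable_compose[OF _ borel_measurable_nth]) simp
    then show ?thesis unfolding h_def sgn_div_norm vector_scaleR_component by measurable
  qed
  have hM [measurable]: "(\<lambda>\<omega>. h \<omega> $ j) \<in> borel_measurable M" for j
    by (rule measurable_from_subalg[OF subalg hF])
  have h1: "norm (h \<omega>) \<le> 1" for \<omega> unfolding h_def by (simp add: norm_sgn)
  have Zj: "integrable M (\<lambda>\<omega>. Z \<omega> $ j)" for j
    using integrable_inner_left[OF Z, of "axis j 1"] by (simp add: inner_axis)
  have int: "integrable M (\<lambda>\<omega>. h \<omega> $ j * Z \<omega> $ j)" for j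
  proof (rule Bochner_Integration.integrable_bound[OF integrable_norm[OF Zj[of j]]])
    show "AE \<omega> in M. norm (h \<omega> $ j * Z \<omega> $ j) \<le> norm (norm (Z \<omega> $ j))"
    proof (rule AE_I2)
      fix \<omega>
      have "\<bar>h \<omega> $ j\<bar> \<le> 1" using component_le_norm_cart[of "h \<omega>" j] h1[of \<omega>] by linarith
      then show "norm (h \<omega> $ j * Z \<omega> $ j) \<le> norm (norm (Z \<omega> $ j))"
        by (simp add: abs_mult mult_left_le_one_le)
    qed
  qed (use borel_measurable_integrable[OF Zj] in measurable)
  have "AE \<omega> in M. real_cond_exp M F (\<lambda>\<eta>. \<Sum>j\<in>UNIV. h \<eta> $ j * Z \<eta> $ j) \<omega>
      = (\<Sum>j\<in>UNIV. real_cond_exp M F (\<lambda>\<eta>. h \<eta> $ j * Z \<eta> $ j) \<omega>)"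
    using int by (rule real_cond_exp_sum)
  moreover have "AE \<omega> in M. \<forall>j\<in>UNIV. real_cond_exp M F (\<lambda>\<eta>. h \<eta> $ j * Z \<eta> $ j) \<omega>
      = h \<omega> $ j * real_cond_exp M F (\<lambda>\<eta>. Z \<eta> $ j) \<omega>"
    by (intro AE_finite_allI real_cond_exp_mult hF int borel_measurable_integrable[OF Zj]) auto
  moreover have "AE \<omega> in M. real_cond_exp M F (\<lambda>\<eta>. \<Sum>j\<in>UNIV. h \<eta> $ j * Z \<eta> $ j) \<omega>
     \<le> real_cond_exp M F (\<lambda>\<eta>. norm (Z \<eta>)) \<omega>"
  proof (rule real_cond_exp_mono)
    show "AE \<omega> in M. (\<Sum>j\<in>UNIV. h \<omega> $ j * Z \<omega> $ j) \<le> norm (Z \<omega>)"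
    proof (rule AE_I2)
      fix \<omega>
      have "(\<Sum>j\<in>UNIV. h \<omega> $ j * Z \<omega> $ j) = h \<omega> \<bullet> Z \<omega>" by (simp add: inner_vec_def)
      also have "\<dots> \<le> norm (h \<omega>) * norm (Z \<omega>)" by (rule norm_cauchy_schwarz)
      also have "\<dots> \<le> norm (Z \<omega>)" using h1 by (simp add: mult_left_le_one_le)
      finally show "(\<Sum>j\<in>UNIV. h \<omega> $ j * Z \<omega> $ j) \<le> norm (Z \<omega>)" .
    qed
  qed (use int Z in auto)
  ultimately show ?thesis
  proof eventually_elim
    case (elim \<omega>)
    have "norm (U \<omega>) = h \<omega> \<bullet> U \<omega>"
      by (cases "U \<omega> = 0") (simp_all add: h_def sgn_div_norm dot_square_norm power2_eq_square)
    also have "\<dots> = (\<Sum>j\<in>UNIV. h \<omega> $ j * real_cond_exp M F (\<lambda>\<eta>. Z \<eta> $ j) \<omega>)"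
      by (simp add: inner_vec_def U_def vcond_exp_nth)
    finally show ?case using elim by (simp add: U_def)
  qed
qed

end

text \<open>As \<open>g\<close> is the conditional expectation of \<open>G\<close>, the bias is that
  of \<open>clip lam G - G\<close>, to which the tail estimate applies. The variance is compared
  with the deviation from \<open>g\<close>: twice 9 from that deviation and twice 3 from the squared
  bias make 24.\<close>

lemma clipped_cond_exp_bounds:
  fixes G g :: "'a \<Rightarrow> real^'n"
  assumes M: "prob_space M" and sub: "subalgebra M F"
    and g [measurable]: "g \<in> borel_measurable F"
    and G: "integrable M G"
    and unbiased: "AE \<omega> in M. vcond_exp M F G \<omega> = g \<omega>"
    and moment: "AE \<omega> in M. nn_cond_exp M F (\<lambda>\<eta>. ennreal (norm (G \<eta> - g \<eta>) powr p)) \<omega>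
        \<le> ennreal (\<sigma> powr p)"
    and lam: "0 < lam" and p: "1 < p" "p \<le> 2"
  shows "AE \<omega> in M. norm (g \<omega>) \<le> lam / 2 \<longrightarrow>
      norm (vcond_exp M F (\<lambda>\<eta>. clip lam (G \<eta>)) \<omega> - g \<omega>) \<le> 2 * \<sigma> powr p * lam powr (1 - p) \<and>
      real_cond_exp M F (\<lambda>\<eta>. (norm (clip lam (G \<eta>) - vcond_exp M F (\<lambda>\<eta>. clip lam (G \<eta>)) \<eta>))\<^sup>2) \<omega>
        \<le> 24 * \<sigma> powr p * lam powr (2 - p)"
proof -
  interpret prob_space M by (rule M)
  interpret finite_measure_subalgebra M F by unfold_locales (rule sub)
  have [measurable]: "G \<in> borel_measurable M" using G by simp
  have [measurable]: "g \<in> borel_measurable M" by (rule measurable_from_subalg[OF sub g])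
  define s where "s = \<sigma> powr p"
  have s: "0 \<le> s" unfolding s_def by simp
  define D where "D = (\<lambda>\<eta>. norm (G \<eta> - g \<eta>) powr p)"
  have [measurable]: "D \<in> borel_measurable M" unfolding D_def by measurable
  have D0: "0 \<le> D \<eta>" for \<eta> unfolding D_def by simp
  have D_int: "integrable M D"
  proof (rule integrableI_nonneg)
    \<comment> \<open>Testing the bound on \<open>nn_cond_exp\<close> against the constant 1 shows
      that the moment is finite; \<open>real_cond_exp\<close> would turn an infinite moment into
      0.\<close>
    have "(\<integral>\<^sup>+\<omega>. ennreal (D \<omega>) \<partial>M) = (\<integral>\<^sup>+\<omega>. 1 * nn_cond_exp M F (\<lambda>\<eta>. ennreal (D \<eta>)) \<omega> \<partial>M)"
      by (subst nn_cond_exp_intg) simp_all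
    also have "\<dots> \<le> (\<integral>\<^sup>+\<omega>. ennreal s \<partial>M)"
      using moment unfolding D_def s_def by (intro nn_integral_mono_AE) simp
    also have "\<dots> < \<infinity>" by (simp add: emeasure_space_1)
    finally show "(\<integral>\<^sup>+\<omega>. ennreal (D \<omega>) \<partial>M) < \<infinity>" .
  qed (use D0 in auto)
  have "AE \<omega> in M. ennreal \<bar>real_cond_exp M F D \<omega>\<bar> \<le> nn_cond_exp M F (\<lambda>\<eta>. ennreal \<bar>D \<eta>\<bar>) \<omega>"
    by (rule real_cond_exp_abs) simp
  then have ED: "AE \<omega> in M. real_cond_exp M F D \<omega> \<le> s"
    using moment
  proof eventually_elim
    case (elim \<omega>)
    have "nn_cond_exp M F (\<lambda>\<eta>. ennreal \<bar>D \<eta>\<bar>) \<omega> \<le> ennreal s"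
      using elim(2) by (simp add: D_def s_def)
    with elim(1) have "ennreal \<bar>real_cond_exp M F D \<omega>\<bar> \<le> ennreal s" by (rule order_trans)
    then show ?case using s by (simp add: ennreal_le_iff)
  qed

  define C where "C = (\<lambda>\<eta>. clip lam (G \<eta>))"
  define U where "U = vcond_exp M F C"
  \<comment> \<open>The indicator of the gradient bound is measurable with respect to
    \<open>F\<close>, so it can be pulled out of the conditional expectation; the pointwise clipping
    estimates are available only under it.\<close>
  define H where "H = (\<lambda>\<omega>. if norm (g \<omega>) \<le> lam / 2 then 1 else 0 :: real)"
  have [measurable]: "H \<in> borel_measurable F" unfolding H_def by measurable
  have [measurable]: "H \<in> borel_measurable M" by (rule measurable_from_subalg[OF sub]) simp
  have [measurable]: "C \<in> borel_measurable M" unfolding C_def by measurable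
  have [measurable]: "U \<in> borel_measurable M"
    by (rule measurable_from_subalg[OF sub]) (simp add: U_def)
  have C_le: "norm (C \<eta>) \<le> lam" for \<eta> unfolding C_def using lam by (intro norm_clip_le) simp
  have C_int: "integrable M C"
    by (rule integrable_const_bound[of _ lam]) (auto simp: C_le)
  have comp: "integrable M (\<lambda>\<omega>. Z \<omega> $ j)" if "integrable M Z" for Z :: "'a \<Rightarrow> real^'n" and j
    using integrable_inner_left[OF that, of "axis j 1"] by (simp add: inner_axis)

  have "AE \<omega> in M. \<forall>j\<in>UNIV. real_cond_exp M F (\<lambda>\<eta>. C \<eta> $ j - G \<eta> $ j) \<omega>
      = real_cond_exp M F (\<lambda>\<eta>. C \<eta> $ j) \<omega> - real_cond_exp M F (\<lambda>\<eta>. G \<eta> $ j) \<omega>"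
    by (intro AE_finite_allI real_cond_exp_diff comp C_int G) auto
  moreover note unbiased
  moreover have "AE \<omega> in M. norm (vcond_exp M F (\<lambda>\<eta>. C \<eta> - G \<eta>) \<omega>)
      \<le> real_cond_exp M F (\<lambda>\<eta>. norm (C \<eta> - G \<eta>)) \<omega>"
    by (intro norm_vcond_exp_le Bochner_Integration.integrable_diff C_int G)
  moreover have int1: "integrable M (\<lambda>\<eta>. H \<eta> * norm (C \<eta> - G \<eta>))"
    by (rule Bochner_Integration.integrable_bound[OF Bochner_Integration.integrable_diff[OF C_int G]])
       (auto simp: H_def)
  then have "AE \<omega> in M. real_cond_exp M F (\<lambda>\<eta>. H \<eta> * norm (C \<eta> - G \<eta>)) \<omega>
      = H \<omega> * real_cond_exp M F (\<lambda>\<eta>. norm (C \<eta> - G \<eta>)) \<omega>"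
    by (intro real_cond_exp_mult) auto
  moreover have "AE \<omega> in M. real_cond_exp M F (\<lambda>\<eta>. H \<eta> * norm (C \<eta> - G \<eta>)) \<omega>
      \<le> real_cond_exp M F (\<lambda>\<eta>. 2 * lam powr (1 - p) * D \<eta>) \<omega>"
  proof (rule real_cond_exp_mono)
    show "AE \<omega> in M. H \<omega> * norm (C \<omega> - G \<omega>) \<le> 2 * lam powr (1 - p) * D \<omega>"
      using norm_clip_diff_le_powr[OF lam _ p] by (auto simp: H_def C_def D_def)
  qed (use int1 D_int in auto)
  moreover have "AE \<omega> in M. real_cond_exp M F (\<lambda>\<eta>. 2 * lam powr (1 - p) * D \<eta>) \<omega>
      = 2 * lam powr (1 - p) * real_cond_exp M F D \<omega>"
    using D_int by (rule real_cond_exp_cmult)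
  moreover note ED
  ultimately have bias: "AE \<omega> in M. norm (g \<omega>) \<le> lam / 2 \<longrightarrow>
      norm (U \<omega> - g \<omega>) \<le> 2 * s * lam powr (1 - p)"
  proof eventually_elim
    case (elim \<omega>)
    show ?case
    proof
      assume "norm (g \<omega>) \<le> lam / 2"
      then have H1: "H \<omega> = 1" by (simp add: H_def)
      have "vcond_exp M F (\<lambda>\<eta>. C \<eta> - G \<eta>) \<omega> = U \<omega> - vcond_exp M F G \<omega>"
        using elim(1) by (simp add: vec_eq_iff vcond_exp_nth U_def)
      then have "norm (U \<omega> - g \<omega>) \<le> 2 * lam powr (1 - p) * real_cond_exp M F D \<omega>"
        using elim(2-6) H1 by simp
      also have "\<dots> \<le> 2 * lam powr (1 - p) * s" using elim(7) by (intro mult_left_mono) auto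
      finally show "norm (U \<omega> - g \<omega>) \<le> 2 * s * lam powr (1 - p)" by (simp add: mult_ac)
    qed
  qed

  have "AE \<omega> in M. norm (U \<omega>) \<le> real_cond_exp M F (\<lambda>\<eta>. norm (C \<eta>)) \<omega>"
    unfolding U_def by (rule norm_vcond_exp_le[OF C_int])
  moreover have "AE \<omega> in M. real_cond_exp M F (\<lambda>\<eta>. norm (C \<eta>)) \<omega> \<le> real_cond_exp M F (\<lambda>_. lam) \<omega>"
    using C_int by (intro real_cond_exp_mono) (auto simp: C_le)
  moreover have "AE \<omega> in M. real_cond_exp M F (\<lambda>_. lam) \<omega> = lam"
    by (rule real_cond_exp_F_meas) auto
  ultimately have U_le: "AE \<omega> in M. norm (U \<omega>) \<le> lam"
    by eventually_elim simp

  define W where "W = (\<lambda>\<eta>. (norm (C \<eta> - U \<eta>))\<^sup>2)"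
  have [measurable]: "W \<in> borel_measurable M" unfolding W_def by measurable
  have pointwise: "AE \<omega> in M. H \<omega> * W \<omega> \<le> 18 * lam powr (2 - p) * D \<omega> + 6 * s * lam powr (2 - p)"
    using bias U_le
  proof eventually_elim
    case (elim \<omega>)
    show ?case
    proof (cases "norm (g \<omega>) \<le> lam / 2")
      case True
      have dev: "(norm (C \<omega> - g \<omega>))\<^sup>2 \<le> 9 * lam powr (2 - p) * D \<omega>"
        using norm_clip_dev_le_powr[OF lam True p] by (simp add: C_def D_def)
      have b: "norm (U \<omega> - g \<omega>) \<le> 2 * s * lam powr (1 - p)" using elim True by blast
      have "norm (U \<omega> - g \<omega>) \<le> norm (U \<omega>) + norm (g \<omega>)" by (rule norm_triangle_ineq4)
      then have "norm (U \<omega> - g \<omega>) \<le> 3 / 2 * lam" using elim True by linarith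
      \<comment> \<open>One factor of the square takes the bias bound, the other the crude bound
        \<open>3/2 lam\<close>, so that only one power of \<open>s\<close> remains.\<close>
      with b have "(norm (U \<omega> - g \<omega>))\<^sup>2 \<le> (2 * s * lam powr (1 - p)) * (3 / 2 * lam)"
        unfolding power2_eq_square using s by (intro mult_mono) auto
      also have "\<dots> = 3 * s * lam powr (2 - p)"
        using lam powr_add[of lam "1 - p" 1] by simp
      finally have b2: "(norm (U \<omega> - g \<omega>))\<^sup>2 \<le> 3 * s * lam powr (2 - p)" .
      have "norm (C \<omega> - U \<omega>) \<le> norm (C \<omega> - g \<omega>) + norm (U \<omega> - g \<omega>)"
        using norm_triangle_ineq4[of "C \<omega> - g \<omega>" "U \<omega> - g \<omega>"] by simp
      then have "W \<omega> \<le> (norm (C \<omega> - g \<omega>) + norm (U \<omega> - g \<omega>))\<^sup>2"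
        unfolding W_def by (intro power_mono) auto
      also have "\<dots> \<le> 2 * (norm (C \<omega> - g \<omega>))\<^sup>2 + 2 * (norm (U \<omega> - g \<omega>))\<^sup>2"
        using sum_squares_bound[of "norm (C \<omega> - g \<omega>)" "norm (U \<omega> - g \<omega>)"]
        by (simp add: power2_sum)
      finally show ?thesis using dev b2 True by (simp add: H_def)
    next
      case False
      then show ?thesis using D0[of \<omega>] s by (simp add: H_def)
    qed
  qed
  have int2: "integrable M (\<lambda>\<eta>. H \<eta> * W \<eta>)"
  proof (rule integrable_const_bound)
    show "AE \<omega> in M. norm (H \<omega> * W \<omega>) \<le> (2 * lam)\<^sup>2"
      using U_le
    proof eventually_elim
      case (elim \<omega>)
      have "norm (C \<omega> - U \<omega>) \<le> norm (C \<omega>) + norm (U \<omega>)" by (rule norm_triangle_ineq4)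
      then have "norm (C \<omega> - U \<omega>) \<le> 2 * lam" using elim C_le[of \<omega>] by linarith
      then have "W \<omega> \<le> (2 * lam)\<^sup>2" unfolding W_def by (intro power_mono) auto
      then show ?case by (auto simp: H_def W_def)
    qed
  qed measurable
  have int3: "integrable M (\<lambda>\<eta>. 18 * lam powr (2 - p) * D \<eta>)" using D_int by simp
  have "AE \<omega> in M. real_cond_exp M F (\<lambda>\<eta>. H \<eta> * W \<eta>) \<omega> = H \<omega> * real_cond_exp M F W \<omega>"
    using int2 by (intro real_cond_exp_mult) auto
  moreover have "AE \<omega> in M. real_cond_exp M F (\<lambda>\<eta>. H \<eta> * W \<eta>) \<omega>
      \<le> real_cond_exp M F (\<lambda>\<eta>. 18 * lam powr (2 - p) * D \<eta> + 6 * s * lam powr (2 - p)) \<omega>"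
    using pointwise int2 int3 by (intro real_cond_exp_mono) auto
  moreover have "AE \<omega> in M. real_cond_exp M F (\<lambda>\<eta>. 18 * lam powr (2 - p) * D \<eta> + 6 * s * lam powr (2 - p)) \<omega>
      = real_cond_exp M F (\<lambda>\<eta>. 18 * lam powr (2 - p) * D \<eta>) \<omega>
        + real_cond_exp M F (\<lambda>_. 6 * s * lam powr (2 - p)) \<omega>"
    using int3 by (intro real_cond_exp_add) auto
  moreover have "AE \<omega> in M. real_cond_exp M F (\<lambda>\<eta>. 18 * lam powr (2 - p) * D \<eta>) \<omega>
      = 18 * lam powr (2 - p) * real_cond_exp M F D \<omega>"
    using D_int by (rule real_cond_exp_cmult)
  moreover have "AE \<omega> in M. real_cond_exp M F (\<lambda>_. 6 * s * lam powr (2 - p)) \<omega> = 6 * s * lam powr (2 - p)"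
    by (rule real_cond_exp_F_meas) auto
  moreover note ED
  ultimately have "AE \<omega> in M. norm (g \<omega>) \<le> lam / 2 \<longrightarrow>
      real_cond_exp M F W \<omega> \<le> 24 * s * lam powr (2 - p)"
  proof eventually_elim
    case (elim \<omega>)
    have "18 * lam powr (2 - p) * real_cond_exp M F D \<omega> \<le> 18 * lam powr (2 - p) * s"
      using elim(6) by (intro mult_left_mono) auto
    then show ?case using elim(1-5) by (auto simp: H_def mult_ac)
  qed
  with bias show ?thesis unfolding s_def U_def C_def W_def by eventually_elim blast
qed

subsection \<open>The schedule of stepsizes and clipping levels\<close>

text \<open>Cauchy condensation: \<open>2^n b(2^n) = (1 + n ln 2)^(-g)\<close>, which
  \<open>ln 2 < 1\<close> bounds by a multiple of \<open>(n + 1)^(-g)\<close>.\<close>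

lemma bertrand_summable:
  fixes g :: real
  assumes "g > 1"
  shows "summable (\<lambda>n. 1 / (real (Suc n) * (1 + ln (real (Suc n))) powr g))"
proof -
  define b where "b = (\<lambda>n::nat. 1 / (real n * (1 + ln (real n)) powr g))"
  have mono: "b n \<ge> b (Suc n)" if "n > 0" for n
  proof -
    have "0 \<le> ln (real n)" using that by simp
    moreover have "ln (real n) \<le> ln (real (Suc n))" using that by simp
    ultimately have *: "0 < 1 + ln (real n)" "1 + ln (real n) \<le> 1 + ln (real (Suc n))" by linarith+
    then have "real n * (1 + ln (real n)) powr g \<le> real (Suc n) * (1 + ln (real (Suc n))) powr g"
      using assms by (intro mult_mono powr_mono2) auto
    moreover have "0 < real n * (1 + ln (real n)) powr g" using * that by simp
    ultimately show ?thesis unfolding b_def by (intro frac_le) auto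
  qed
  have nn: "b n \<ge> 0" for n unfolding b_def by simp
  have "summable (\<lambda>n. 2 ^ n * b (2 ^ n))"
  proof (rule summable_comparison_test')
    have "summable (\<lambda>n. real n powr (-g))" using assms by (simp add: summable_real_powr_iff)
    then have "summable (\<lambda>n. real (Suc n) powr (-g))"
      by (rule iffD2[OF summable_Suc_iff[of "\<lambda>n. real n powr (-g)"]])
    then show "summable (\<lambda>n. ln 2 powr (-g) * real (Suc n) powr (-g))"
      by (rule summable_mult)
    fix n :: nat
    have "ln 2 * real (Suc n) \<le> 1 + real n * ln 2"
      using ln_2_less_1 by (simp add: algebra_simps)
    then have "(1 + real n * ln 2) powr (-g) \<le> (ln 2 * real (Suc n)) powr (-g)"
      using assms by (intro powr_mono2') auto
    also have "\<dots> = ln 2 powr (-g) * real (Suc n) powr (-g)"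
      by (simp add: powr_mult)
    finally show "norm (2 ^ n * b (2 ^ n)) \<le> ln 2 powr (-g) * real (Suc n) powr (-g)"
      by (simp add: b_def ln_realpow powr_minus_divide)
  qed
  then have "summable b"
    using condensation_test[of b, OF mono nn] by blast
  then show ?thesis unfolding b_def by (subst summable_Suc_iff)
qed

section \<open>The last communication time \<open>tau\<close>\<close>

lemma tau_eq:
  assumes "1 \<le> P" "1 + P < t"
  obtains k where "1 \<le> k" "tau P t = 1 + k * P" "1 + k * P \<le> t" "t < 1 + k * P + P"
proof -
  define K where "K = {1 + k * P | k. 1 \<le> k \<and> 1 + k * P \<le> t}"
  have K: "tau P t = Max K" using assms by (simp add: tau_def K_def)
  have fin: "finite K" by (rule finite_subset[of _ "{..t}"]) (auto simp: K_def)
  have "1 + 1 * P \<in> K" unfolding K_def using assms by (intro CollectI exI[of _ 1]) auto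
  then have "Max K \<in> K" using fin by (intro Max_in) auto
  then obtain k where k: "1 \<le> k" "Max K = 1 + k * P" "1 + k * P \<le> t"
    unfolding K_def mem_Collect_eq by metis
  have "t < 1 + k * P + P"
  proof (rule ccontr)
    assume "\<not> ?thesis"
    then have "1 + Suc k * P \<in> K" unfolding K_def by (intro CollectI exI[of _ "Suc k"]) auto
    then have "1 + Suc k * P \<le> Max K" using fin by simp
    then show False using k(2) assms by simp
  qed
  with k K show ?thesis by (intro that[of k]) simp_all
qed

lemma tau_first: "t \<le> 1 + P \<Longrightarrow> tau P t = 1"
  by (simp add: tau_def)

lemma tau_ge_1:
  assumes "1 \<le> P"
  shows "1 \<le> tau P t"
proof (cases "t \<le> 1 + P")
  case False
  then obtain k where "tau P t = 1 + k * P" using tau_eq[OF assms, of t] not_le by blast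
  then show ?thesis by simp
qed (simp add: tau_first)

lemma tau_gt_diff:
  assumes "1 \<le> P" "P < t"
  shows "t - P \<le> tau P t"
proof (cases "t \<le> 1 + P")
  case False
  then obtain k where "tau P t = 1 + k * P" "t < 1 + k * P + P"
    using tau_eq[OF assms(1), of t] not_le by blast
  then show ?thesis by linarith
qed (use assms in \<open>simp add: tau_first\<close>)

lemma tau_le:
  assumes "1 \<le> P" "1 \<le> t"
  shows "tau P t \<le> t"
proof (cases "t \<le> 1 + P")
  case False
  then obtain k where "tau P t = 1 + k * P" "1 + k * P \<le> t"
    using tau_eq[OF assms(1), of t] not_le by blast
  then show ?thesis by linarith
qed (use assms in \<open>simp add: tau_first\<close>)

text \<open>Since \<open>tau P t\<close> lags behind \<open>t\<close> by at most \<open>P\<close>,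
  monotonicity gives \<open>u (tau P t) \<le> u (t - P)\<close> for \<open>t > P\<close>, and
  shifting a series by \<open>P\<close> does not affect convergence.\<close>

lemma summable_tau:
  fixes u :: "nat \<Rightarrow> real"
  assumes P: "1 \<le> P"
    and nonneg: "\<And>t. 1 \<le> t \<Longrightarrow> 0 \<le> u t"
    and anti: "\<And>s t. 1 \<le> s \<Longrightarrow> s \<le> t \<Longrightarrow> u t \<le> u s"
    and sums: "summable (\<lambda>t. u (Suc t))"
  shows "summable (\<lambda>t. u (tau P (Suc t)))"
proof -
  have "summable (\<lambda>n. u (tau P (Suc (n + P))))"
  proof (rule summable_comparison_test')
    show "summable (\<lambda>n. u (Suc n))" by (rule sums)
    fix n
    have "Suc n \<le> tau P (Suc (n + P))" using tau_gt_diff[OF P, of "Suc (n + P)"] by simp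
    then show "norm (u (tau P (Suc (n + P)))) \<le> u (Suc n)"
      using nonneg[OF tau_ge_1[OF P], of "Suc (n + P)"] anti[of "Suc n" "tau P (Suc (n + P))"]
      by (metis abs_of_nonneg le_add1 plus_1_eq_Suc real_norm_def)
  qed
  then show ?thesis by (subst (asm) summable_iff_shift[of "\<lambda>t. u (tau P (Suc t))"])
qed

text \<open>Comparing the minimizer only with \<open>x\<close> costs a factor 2 against the first-order optimality
  condition, which the constants in \<open>A\<close> can afford.\<close>
lemma norm_step_le:
  fixes c :: "real^'n"
  assumes "0 < a"
    and opt: "c \<bullet> y + 1 / a * bregman Phi gPhi y x \<le> c \<bullet> x + 1 / a * bregman Phi gPhi x x"
    and sc: "1/2 * (norm (y - x))\<^sup>2 \<le> bregman Phi gPhi y x"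
  shows "norm (y - x) \<le> 2 * a * norm c"
proof -
  have "1 / a * bregman Phi gPhi y x \<le> c \<bullet> (x - y)"
    using opt by (simp add: bregman_def inner_diff_right)
  also have "\<dots> \<le> norm c * norm (y - x)"
    by (metis norm_cauchy_schwarz norm_minus_commute)
  finally have "bregman Phi gPhi y x \<le> a * norm c * norm (y - x)"
    using \<open>0 < a\<close> by (simp add: field_simps)
  with sc have "norm (y - x) * norm (y - x) \<le> (2 * a * norm c) * norm (y - x)"
    by (simp add: power2_eq_square)
  then show ?thesis using \<open>0 < a\<close> by (cases "norm (y - x) = 0") (auto simp: mult_le_cancel_right)
qed

text \<open>The threshold is an abstract \<open>Q \<ge> 0\<close>, so that convergence of the series
  is settled without reference to \<open>A\<close>, which they define.\<close>

locale clipping_schedule =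
  fixes \<kappa> \<mu> \<gamma> p Q :: real and alpha lam :: "nat \<Rightarrow> real"
  assumes Q_nonneg: "0 \<le> Q" and mu_pos: "0 < \<mu>" and gamma_gt: "1 < \<gamma>" and p_gt: "1 < p"
    and kappa_ge_half: "\<mu> + 1 / 2 \<le> \<kappa>" and kappa_ge_p: "1 - \<mu> * (p - 1) \<le> \<kappa>"
    and alpha_eq: "alpha t = 1 / ((1 + ln (real t)) powr \<gamma> * real t powr (\<kappa> - \<mu>))
        * min (1 / real t powr \<mu>) (1 / Q)"
    and lam_eq: "lam t = max (real t powr \<mu>) Q"
begin

text \<open>This is the value of \<open>alpha t * lam t\<close> for \<open>Q > 0\<close>, where
  minimum and maximum cancel. So the product decreases although \<open>lam\<close> grows.\<close>

definition w :: "nat \<Rightarrow> real" where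
  "w t = 1 / ((1 + ln (real t)) powr \<gamma> * real t powr (\<kappa> - \<mu>))"

lemma one_plus_ln_pos: "1 \<le> t \<Longrightarrow> 0 < 1 + ln (real t)"
  by (simp add: add_pos_nonneg)

lemma w_1: "w 1 = 1"
  by (simp add: w_def)

lemma w_nonneg: "0 \<le> w t"
  by (simp add: w_def)

lemma w_antimono:
  assumes "1 \<le> s" "s \<le> t"
  shows "w t \<le> w s"
proof -
  have "0 \<le> ln (real s)" "ln (real s) \<le> ln (real t)" using assms by auto
  then have "(1 + ln (real s)) powr \<gamma> * real s powr (\<kappa> - \<mu>) \<le> (1 + ln (real t)) powr \<gamma> * real t powr (\<kappa> - \<mu>)"
    using assms gamma_gt kappa_ge_half by (intro mult_mono powr_mono2) auto
  moreover have "0 < (1 + ln (real s)) powr \<gamma> * real s powr (\<kappa> - \<mu>)"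
    using assms one_plus_ln_pos[OF assms(1)] by auto
  ultimately show ?thesis unfolding w_def by (intro frac_le) auto
qed

lemma w_le_1: "1 \<le> t \<Longrightarrow> w t \<le> 1"
  using w_antimono[of 1 t] w_1 by simp

lemma lam_ge: "1 \<le> t \<Longrightarrow> 1 \<le> lam t" "real t powr \<mu> \<le> lam t" "Q \<le> lam t"
  using mu_pos by (auto simp: lam_eq intro!: max.coboundedI1 ge_one_powr_ge_zero)

lemma alpha_nonneg: "0 \<le> alpha t"
  using Q_nonneg by (simp add: alpha_eq)

lemma alpha_le_1:
  assumes "1 \<le> t"
  shows "alpha t \<le> 1"
proof -
  have "min (1 / real t powr \<mu>) (1 / Q) \<le> 1 / real t powr \<mu>" by simp
  also have "\<dots> \<le> 1" using assms mu_pos by (simp add: ge_one_powr_ge_zero)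
  finally have "w t * min (1 / real t powr \<mu>) (1 / Q) \<le> 1 * 1"
    using w_le_1[OF assms] w_nonneg Q_nonneg by (intro mult_mono) auto
  then show ?thesis by (simp add: alpha_eq w_def)
qed

lemma alpha_lam:
  assumes "1 \<le> t" "0 < Q"
  shows "alpha t * lam t = w t"
proof -
  have "0 < real t powr \<mu>" using assms by simp
  then have "min (1 / real t powr \<mu>) (1 / Q) * max (real t powr \<mu>) Q = 1"
    using assms by (auto simp: min_def max_def field_simps)
  then show ?thesis unfolding alpha_eq lam_eq w_def by (simp add: mult.assoc)
qed

text \<open>For \<open>Q = 0\<close> the convention \<open>1 / 0 = 0\<close> makes all stepsizes vanish.\<close>
lemma alpha_Q0: "Q = 0 \<Longrightarrow> alpha t = 0"
  by (simp add: alpha_eq)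

lemma alpha_lam_nonneg: "1 \<le> t \<Longrightarrow> 0 \<le> alpha t * lam t"
  using alpha_nonneg[of t] lam_ge(1)[of t] by simp

lemma alpha_lam_le: "1 \<le> t \<Longrightarrow> alpha t * lam t \<le> w t"
  using alpha_lam[of t] alpha_Q0[of t] w_nonneg[of t] Q_nonneg by (cases "Q = 0") auto

lemma alpha_lam_antimono:
  assumes "1 \<le> s" "s \<le> t"
  shows "alpha t * lam t \<le> alpha s * lam s"
  using alpha_lam[of t] alpha_lam[of s] alpha_Q0 w_antimono[OF assms] Q_nonneg assms
  by (cases "Q = 0") auto

lemma bertrand_bound:
  assumes "1 \<le> t" "1 \<le> e" "\<gamma> \<le> g"
  shows "1 / ((1 + ln (real t)) powr g * real t powr e) \<le> 1 / (real t * (1 + ln (real t)) powr \<gamma>)"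
proof -
  have "0 \<le> ln (real t)" using assms by simp
  moreover have "real t * (1 + ln (real t)) powr \<gamma> \<le> real t powr e * (1 + ln (real t)) powr g"
    using assms \<open>0 \<le> ln (real t)\<close> powr_mono[of 1 e "real t"] by (intro mult_mono powr_mono) auto
  moreover have "0 < real t * (1 + ln (real t)) powr \<gamma>"
    using assms one_plus_ln_pos[OF assms(1)] by auto
  ultimately show ?thesis by (subst mult.commute) (intro frac_le, auto)
qed

text \<open>\<open>\<kappa> \<ge> \<mu> + 1/2\<close> makes the exponent
  \<open>2 (\<kappa> - \<mu>)\<close> of \<open>t\<close> at least 1; in the borderline case the
  logarithmic factor secures convergence.\<close>

lemma summable_w2: "summable (\<lambda>t. (w (Suc t))\<^sup>2)"
proof (rule summable_comparison_test'[OF bertrand_summable[OF gamma_gt]])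
  fix n :: nat
  have "(w (Suc n))\<^sup>2 = 1 / ((1 + ln (real (Suc n))) powr (2 * \<gamma>) * real (Suc n) powr (2 * (\<kappa> - \<mu>)))"
    unfolding w_def by (simp only: mult_2 powr_add power2_eq_square times_divide_times_eq) (simp only: mult_1_left mult_ac)
  also have "\<dots> \<le> 1 / (real (Suc n) * (1 + ln (real (Suc n))) powr \<gamma>)"
    using kappa_ge_half gamma_gt by (intro bertrand_bound) auto
  finally show "norm ((w (Suc n))\<^sup>2) \<le> 1 / (real (Suc n) * (1 + ln (real (Suc n))) powr \<gamma>)" by simp
qed

text \<open>Here \<open>lam t \<ge> t^\<mu>\<close> raises the exponent of \<open>t\<close> to
  \<open>\<kappa> - \<mu> + \<mu> p\<close>, which is at least 1 by the second lower bound on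
  \<open>\<kappa>\<close>.\<close>

lemma summable_bias: "summable (\<lambda>t. alpha (Suc t) * lam (Suc t) powr (1 - p))"
proof (rule summable_comparison_test'[OF bertrand_summable[OF gamma_gt]])
  fix n :: nat
  define t where "t = Suc n"
  have t: "1 \<le> t" by (simp add: t_def)
  note l = lam_ge[of t]
  have "alpha t * lam t powr (1 - p) = alpha t * lam t * lam t powr (-p)"
    using l(1)[OF t] powr_add[of "lam t" 1 "-p"] by simp
  also have "\<dots> \<le> w t * (real t powr \<mu>) powr (-p)"
    using alpha_lam_le[OF t] w_nonneg l(1)[OF t] l(2) p_gt t by (intro mult_mono powr_mono2') auto
  also have "\<dots> = 1 / ((1 + ln (real t)) powr \<gamma> * real t powr (\<kappa> - \<mu> + \<mu> * p))"
    by (simp add: w_def powr_powr powr_add powr_minus_divide)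
  also have "\<dots> \<le> 1 / (real t * (1 + ln (real t)) powr \<gamma>)"
    using kappa_ge_p t by (intro bertrand_bound) (auto simp: algebra_simps)
  finally show "norm (alpha (Suc n) * lam (Suc n) powr (1 - p))
      \<le> 1 / (real (Suc n) * (1 + ln (real (Suc n))) powr \<gamma>)"
    using alpha_nonneg[of "Suc n"] by (simp add: t_def)
qed

text \<open>The summand is the square of the one in \<open>summable_bias\<close>, which is at most
  1.\<close>

lemma summable_bias2: "summable (\<lambda>t. (alpha (Suc t))\<^sup>2 * lam (Suc t) powr (2 - 2 * p))"
proof (rule summable_comparison_test'[OF summable_bias])
  fix n :: nat
  define t where "t = Suc n"
  have t: "1 \<le> t" by (simp add: t_def)
  have l: "1 \<le> lam t" using lam_ge[of t] t by simp
  have "(alpha t)\<^sup>2 * lam t powr (2 - 2 * p) = alpha t * lam t powr (1 - p) * (alpha t * lam t powr (1 - p))"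
    using powr_add[of "lam t" "1 - p" "1 - p"] by (simp add: power2_eq_square)
  also have "\<dots> \<le> alpha t * lam t powr (1 - p) * (1 * 1)"
    using alpha_nonneg[of t] alpha_le_1[OF t] powr_mono[of "1 - p" 0 "lam t"] l p_gt
    by (intro mult_left_mono mult_mono) auto
  finally show "norm ((alpha (Suc n))\<^sup>2 * lam (Suc n) powr (2 - 2 * p))
      \<le> alpha (Suc n) * lam (Suc n) powr (1 - p)" by (simp add: t_def)
qed

text \<open>The cases \<open>q = 2\<close> and \<open>q = 4\<close> give \<open>C_4\<close> and
  \<open>C_5\<close>; since \<open>lam t powr (- p) \<le> 1\<close> and \<open>w t \<le> 1\<close>,
  both reduce to the squares of \<open>w\<close>.\<close>

lemma summable_variance:
  assumes "2 \<le> q"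
  shows "summable (\<lambda>t. (alpha (Suc t) * lam (Suc t)) ^ q * lam (Suc t) powr (- p))"
proof (rule summable_comparison_test'[OF summable_w2])
  fix n :: nat
  define t where "t = Suc n"
  have t: "1 \<le> t" by (simp add: t_def)
  have l: "1 \<le> lam t" using lam_ge[of t] t by simp
  have a: "0 \<le> alpha t * lam t" "alpha t * lam t \<le> w t"
    using alpha_lam_nonneg[OF t] alpha_lam_le[OF t] .
  have "(alpha t * lam t) ^ q \<le> w t ^ q" using a by (intro power_mono) auto
  also have "\<dots> \<le> (w t)\<^sup>2" using assms w_nonneg w_le_1[OF t] by (intro power_decreasing) auto
  finally have "(alpha t * lam t) ^ q * lam t powr (-p) \<le> (w t)\<^sup>2 * 1"
    using powr_mono[of "-p" 0 "lam t"] l p_gt by (intro mult_mono) auto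
  then show "norm ((alpha (Suc n) * lam (Suc n)) ^ q * lam (Suc n) powr (- p)) \<le> (w (Suc n))\<^sup>2"
    using a(1) by (simp add: t_def)
qed

text \<open>The square of \<open>w (tau P t)\<close> dominates both summands: in the first
  \<open>alpha t \<le> 1\<close>, in the second \<open>w t \<le> w (tau P t)\<close> because
  \<open>tau P t \<le> t\<close>.\<close>

lemma summable_drift:
  assumes P: "1 \<le> P"
  shows "summable (\<lambda>t. alpha (Suc t) * (alpha (tau P (Suc t)))\<^sup>2 * (lam (tau P (Suc t)))\<^sup>2)"
    and "summable (\<lambda>t. alpha (Suc t) * alpha (tau P (Suc t)) * lam (Suc t) * lam (tau P (Suc t)))"
proof -
  have sum: "summable (\<lambda>t. (w (tau P (Suc t)))\<^sup>2)"
    by (rule summable_tau[OF P _ _ summable_w2]) (auto intro!: power_mono w_antimono w_nonneg)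
  have le: "0 \<le> alpha (tau P t) * lam (tau P t)" "alpha (tau P t) * lam (tau P t) \<le> w (tau P t)" for t
    using alpha_lam_nonneg[OF tau_ge_1[OF P]] alpha_lam_le[OF tau_ge_1[OF P]] .
  show "summable (\<lambda>t. alpha (Suc t) * (alpha (tau P (Suc t)))\<^sup>2 * (lam (tau P (Suc t)))\<^sup>2)"
  proof (rule summable_comparison_test'[OF sum])
    fix n
    have "alpha (Suc n) * (alpha (tau P (Suc n)) * lam (tau P (Suc n)))\<^sup>2 \<le> 1 * (w (tau P (Suc n)))\<^sup>2"
      using alpha_nonneg alpha_le_1[of "Suc n"] le[of "Suc n"] by (intro mult_mono power_mono) auto
    then show "norm (alpha (Suc n) * (alpha (tau P (Suc n)))\<^sup>2 * (lam (tau P (Suc n)))\<^sup>2) \<le> (w (tau P (Suc n)))\<^sup>2"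
      using alpha_nonneg[of "Suc n"] by (simp add: power_mult_distrib mult.assoc)
  qed
  show "summable (\<lambda>t. alpha (Suc t) * alpha (tau P (Suc t)) * lam (Suc t) * lam (tau P (Suc t)))"
  proof (rule summable_comparison_test'[OF sum])
    fix n
    have "alpha (Suc n) * lam (Suc n) \<le> w (Suc n)" by (rule alpha_lam_le) simp
    also have "\<dots> \<le> w (tau P (Suc n))"
      by (intro w_antimono tau_ge_1 tau_le P) simp
    finally have "(alpha (Suc n) * lam (Suc n)) * (alpha (tau P (Suc n)) * lam (tau P (Suc n)))
        \<le> w (tau P (Suc n)) * w (tau P (Suc n))"
      using alpha_lam_nonneg[of "Suc n"] le[of "Suc n"] w_nonneg by (intro mult_mono) auto
    moreover have "0 \<le> (alpha (Suc n) * lam (Suc n)) * (alpha (tau P (Suc n)) * lam (tau P (Suc n)))"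
      using alpha_lam_nonneg[of "Suc n"] le[of "Suc n"] by simp
    ultimately show "norm (alpha (Suc n) * alpha (tau P (Suc n)) * lam (Suc n) * lam (tau P (Suc n))) \<le> (w (tau P (Suc n)))\<^sup>2"
      by (simp add: power2_eq_square mult_ac)
  qed
qed

end

subsection \<open>The induction along a sample path\<close>

lemma sum_le_suminf_Suc:
  fixes u :: "nat \<Rightarrow> real"
  assumes "summable (\<lambda>t. u (Suc t))" "\<And>t. 1 \<le> t \<Longrightarrow> 0 \<le> u t"
  shows "(\<Sum>t=1..S. u t) \<le> (\<Sum>t. u (Suc t))"
  unfolding One_nat_def sum.atLeast1_atMost_eq using assms by (intro sum_le_suminf) auto

text \<open>All data are those of one fixed sample point: \<open>gr\<close> the true gradients at the iterates, \<open>tb\<close> the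
  clipping bias, \<open>vu\<close> the conditional variance, \<open>D\<close> the divergence from \<open>xstar\<close>.\<close>
locale fedsmd_path = clipping_schedule +
  fixes m P Tc T :: nat and L R1 A \<delta> \<sigma> B :: real
    and x y gr tb :: "nat \<Rightarrow> nat \<Rightarrow> real^'n" and xstar :: "real^'n"
    and gap D vu :: "nat \<Rightarrow> nat \<Rightarrow> real" and V :: "nat \<Rightarrow> real"
  assumes m_pos: "1 \<le> m" and P_pos: "1 \<le> P" and T_eq: "T = 1 + Tc * P"
    and L_nonneg: "0 \<le> L" and B_nonneg: "0 \<le> B" and A_pos: "0 < A"
    and delta: "0 < \<delta>" "\<delta> < 1"
    and Q_eq: "Q = 2 * real m * L * (2 * R1 + 10 * A) + 2 * B"
    and A_eq: "A = ln (1 / \<delta>)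
        + real m * L * (real P)\<^sup>2 * (\<Sum>t. alpha (Suc t) * (alpha (tau P (Suc t)))\<^sup>2 * (lam (tau P (Suc t)))\<^sup>2)
        + 2 * real m * real P * (\<Sum>t. alpha (Suc t) * alpha (tau P (Suc t)) * lam (Suc t) * lam (tau P (Suc t)))
        + 4 * \<sigma> powr p * (\<Sum>t. alpha (Suc t) * lam (Suc t) powr (1 - p))
        + 16 * real m * \<sigma> powr (2 * p) * (\<Sum>t. (alpha (Suc t))\<^sup>2 * lam (Suc t) powr (2 - 2 * p))
        + 40 * real m * \<sigma> powr p * (1 + 3 * real m) * (\<Sum>t. (alpha (Suc t) * lam (Suc t))\<^sup>2 * lam (Suc t) powr (- p))
        + 40 * (real m)\<^sup>2 * \<sigma> powr p * (\<Sum>t. (alpha (Suc t) * lam (Suc t)) ^ 4 * lam (Suc t) powr (- p))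
        + 8 * real m"
    and V_eq: "V t = 2 * real m * Max {sqrt (2 * D i s) | i s. i \<in> {1..m} \<and> s \<in> {1..t}} + A"
    and dist_D: "\<lbrakk>i \<in> {1..m}; t \<in> {1..T + 1}\<rbrakk> \<Longrightarrow> 1 / 2 * (norm (xstar - x i t))\<^sup>2 \<le> D i t"
    and D_init: "i \<in> {1..m} \<Longrightarrow> sqrt (2 * D i 1) \<le> R1"
    and gr_init: "i \<in> {1..m} \<Longrightarrow> norm (gr i 1) \<le> B"
    and gr_lip: "\<lbrakk>i \<in> {1..m}; t \<in> {1..T}\<rbrakk> \<Longrightarrow> norm (gr i t - gr i 1) \<le> L * norm (x i t - x i 1)"
    and step_le: "\<lbrakk>i \<in> {1..m}; t \<in> {1..T}; 0 < alpha t\<rbrakk>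
        \<Longrightarrow> norm (y i (t + 1) - x i t) \<le> 2 * alpha t * lam t"
    and x_step: "\<lbrakk>i \<in> {1..m}; t \<in> {1..T}\<rbrakk> \<Longrightarrow> x i (t + 1) =
        (if t + 1 \<in> comm_times P Tc then (1 / real m) *\<^sub>R (\<Sum>j=1..m. y j (t + 1)) else y i (t + 1))"
    and gap_nonneg: "\<lbrakk>i \<in> {1..m}; t \<in> {1..T}\<rbrakk> \<Longrightarrow> 0 \<le> gap i t"
    and tb_le: "\<lbrakk>i \<in> {1..m}; t \<in> {1..T}; norm (gr i t) \<le> lam t / 2\<rbrakk>
        \<Longrightarrow> norm (tb i t) \<le> 2 * \<sigma> powr p * lam t powr (1 - p)"
    and vu_le: "\<lbrakk>i \<in> {1..m}; t \<in> {1..T}; norm (gr i t) \<le> lam t / 2\<rbrakk>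
        \<Longrightarrow> vu i t \<le> 24 * \<sigma> powr p * lam t powr (2 - p)"
    and event: "\<lbrakk>l \<in> {1..m}; S \<in> {1..T}\<rbrakk> \<Longrightarrow>
      (\<Sum>t=1..S. alpha t / V t * gap l t) + 1 / V S * (\<Sum>i=1..m. D i (S + 1))
      \<le> ln (1 / \<delta>)
        + 1 / V 1 * (\<Sum>i=1..m. D i 1)
        + (\<Sum>t=1..S. alpha t / V t * (\<Sum>i=1..m. L * (norm (x l t - x i t))\<^sup>2))
        + (\<Sum>t=1..S. alpha t / V t * (\<Sum>i=1..m. norm (gr i t) * norm (x i t - x l t)))
        + (\<Sum>t=1..S. alpha t / V t * (\<Sum>i=1..m. tb i t \<bullet> (xstar - x i t)))
        + (\<Sum>t=1..S. (alpha t)\<^sup>2 / V t * (\<Sum>i=1..m. (norm (tb i t))\<^sup>2))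
        + (\<Sum>t=1..S. ((alpha t)\<^sup>2 / V t + 3 * real m * (alpha t)\<^sup>2
                        + 6 * (alpha t)^4 * (lam t)\<^sup>2 * real m / (V t)\<^sup>2) * (\<Sum>i=1..m. vu i t))"
begin

abbreviation "u t \<equiv> alpha t * lam t"
abbreviation "c0 t \<equiv> alpha t * (alpha (tau P t))\<^sup>2 * (lam (tau P t))\<^sup>2"
abbreviation "c1 t \<equiv> alpha t * alpha (tau P t) * lam t * lam (tau P t)"
abbreviation "c2 t \<equiv> alpha t * lam t powr (1 - p)"
abbreviation "c3 t \<equiv> (alpha t)\<^sup>2 * lam t powr (2 - 2 * p)"
abbreviation "c4 t \<equiv> (u t)\<^sup>2 * lam t powr (- p)"
abbreviation "c5 t \<equiv> u t ^ 4 * lam t powr (- p)"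

section \<open>The budget \<open>A\<close> and the normalisation \<open>V\<close>\<close>

lemma c_nonneg:
  assumes "1 \<le> t"
  shows "0 \<le> c0 t" "0 \<le> c1 t" "0 \<le> c2 t" "0 \<le> c3 t" "0 \<le> c4 t" "0 \<le> c5 t"
  using alpha_nonneg[of t] alpha_nonneg[of "tau P t"] lam_ge(1)[OF assms] lam_ge(1)[OF tau_ge_1[OF P_pos], of t]
  by auto

text \<open>This is where convergence enters: being summable and nonnegative, the series in
  \<open>A_eq\<close> dominate all their partial sums.\<close>

lemma A_bounds:
  shows "8 * real m \<le> A"
    and "ln (1 / \<delta>) + real m * L * (real P)\<^sup>2 * (\<Sum>t=1..S. c0 t) + 2 * real m * real P * (\<Sum>t=1..S. c1 t)
        + 4 * \<sigma> powr p * (\<Sum>t=1..S. c2 t) + 16 * real m * \<sigma> powr (2 * p) * (\<Sum>t=1..S. c3 t)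
        + 40 * real m * \<sigma> powr p * (1 + 3 * real m) * (\<Sum>t=1..S. c4 t)
        + 40 * (real m)\<^sup>2 * \<sigma> powr p * (\<Sum>t=1..S. c5 t) \<le> A"
proof -
  have le: "ln (1 / \<delta>) + real m * L * (real P)\<^sup>2 * (\<Sum>t=1..S. c0 t) + 2 * real m * real P * (\<Sum>t=1..S. c1 t)
        + 4 * \<sigma> powr p * (\<Sum>t=1..S. c2 t) + 16 * real m * \<sigma> powr (2 * p) * (\<Sum>t=1..S. c3 t)
        + 40 * real m * \<sigma> powr p * (1 + 3 * real m) * (\<Sum>t=1..S. c4 t)
        + 40 * (real m)\<^sup>2 * \<sigma> powr p * (\<Sum>t=1..S. c5 t) + 8 * real m \<le> A" for S
    by (subst A_eq, intro add_mono mult_left_mono order_refl sum_le_suminf_Suc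
        summable_drift[OF P_pos] summable_bias summable_bias2 summable_variance)
      (use L_nonneg c_nonneg in auto)
  then show "ln (1 / \<delta>) + real m * L * (real P)\<^sup>2 * (\<Sum>t=1..S. c0 t) + 2 * real m * real P * (\<Sum>t=1..S. c1 t)
        + 4 * \<sigma> powr p * (\<Sum>t=1..S. c2 t) + 16 * real m * \<sigma> powr (2 * p) * (\<Sum>t=1..S. c3 t)
        + 40 * real m * \<sigma> powr p * (1 + 3 * real m) * (\<Sum>t=1..S. c4 t)
        + 40 * (real m)\<^sup>2 * \<sigma> powr p * (\<Sum>t=1..S. c5 t) \<le> A"
    using m_pos by (smt (verit) of_nat_0_le_iff)
  have "0 \<le> ln (1 / \<delta>)" using delta by simp
  \<comment> \<open>The empty sums at \<open>S = 0\<close> leave only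
    \<open>ln (1 / \<delta>) + 8 m\<close>.\<close>
  with le[of 0] show "8 * real m \<le> A" by simp
qed

lemma D_nonneg: "\<lbrakk>i \<in> {1..m}; t \<in> {1..T + 1}\<rbrakk> \<Longrightarrow> 0 \<le> D i t"
  using dist_D[of i t] zero_le_power2[of "norm (xstar - x i t)"] by linarith

lemma R1_nonneg: "0 \<le> R1"
proof -
  have "1 \<in> {1..m}" using m_pos by simp
  then have "0 \<le> sqrt (2 * D 1 1)" using D_nonneg[of 1 1] by simp
  also have "\<dots> \<le> R1" using \<open>1 \<in> {1..m}\<close> by (rule D_init)
  finally show ?thesis .
qed

lemma dist_le: "\<lbrakk>i \<in> {1..m}; t \<in> {1..T + 1}\<rbrakk> \<Longrightarrow> norm (xstar - x i t) \<le> sqrt (2 * D i t)"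
  using dist_D[of i t] by (intro real_le_rsqrt) simp

lemma finite_radii: "finite {sqrt (2 * D i s) | i s. i \<in> {1..m} \<and> s \<in> {1..t::nat}}"
proof (rule finite_subset)
  show "{sqrt (2 * D i s) | i s. i \<in> {1..m} \<and> s \<in> {1..t}}
      \<subseteq> (\<lambda>(i, s). sqrt (2 * D i s)) ` ({1..m} \<times> {1..t})"
    by force
qed simp

lemma V_ge: "\<lbrakk>i \<in> {1..m}; 1 \<le> s; s \<le> t\<rbrakk> \<Longrightarrow> 2 * real m * sqrt (2 * D i s) + A \<le> V t"
  unfolding V_eq by (intro add_right_mono mult_left_mono Max_ge finite_radii) auto

lemma V_mono: "\<lbrakk>1 \<le> s; s \<le> t\<rbrakk> \<Longrightarrow> V s \<le> V t"
  unfolding V_eq using m_pos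
  by (intro add_right_mono mult_left_mono Max_mono finite_radii) (force | blast)+

lemma V_le:
  assumes "1 \<le> t" "\<And>i s. \<lbrakk>i \<in> {1..m}; 1 \<le> s; s \<le> t\<rbrakk> \<Longrightarrow> sqrt (2 * D i s) \<le> \<rho>"
  shows "V t \<le> 2 * real m * \<rho> + A"
proof -
  have "{sqrt (2 * D i s) | i s. i \<in> {1..m} \<and> s \<in> {1..t}} \<noteq> {}" using m_pos assms(1) by auto
  then have "Max {sqrt (2 * D i s) | i s. i \<in> {1..m} \<and> s \<in> {1..t}} \<le> \<rho>"
    using finite_radii assms(2) by (subst Max_le_iff) auto
  then show ?thesis unfolding V_eq by (intro add_right_mono mult_left_mono) auto
qed

lemma V_ge_A:
  assumes "1 \<le> t" "t \<le> T + 1"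
  shows "A \<le> V t"
proof -
  have "0 \<le> 2 * real m * sqrt (2 * D 1 t)" using D_nonneg[of 1 t] m_pos assms by simp
  then show ?thesis using V_ge[of 1 t t] m_pos assms by simp
qed

text \<open>After the communication at \<open>s\<close> all agents agree, and until the next one
  each makes fewer than \<open>P\<close> further moves of length at most \<open>2 u s\<close>, since
  \<open>u\<close> decreases. Comparing two agents doubles this.\<close>

lemma consensus:
  assumes s: "s \<in> comm_times P Tc" and t: "s \<le> t" "t < s + P" "t \<le> T" and Q: "0 < Q"
    and il: "i \<in> {1..m}" "l \<in> {1..m}"
  shows "norm (x l t - x i t) \<le> 4 * real P * u s"
proof -
  obtain k where k: "s = 1 + k * P" "1 \<le> k" using s by (auto simp: comm_times_def)
  have s2: "2 \<le> s" using k P_pos by (simp add: Suc_le_eq)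
  \<comment> \<open>\<open>step_le\<close> speaks of positive stepsizes only; \<open>Q > 0\<close>
    provides them.\<close>
  have alpha_pos: "0 < alpha r" if "1 \<le> r" for r
  proof -
    have "0 < u r" using alpha_lam[OF that Q] that unfolding w_def
      by (simp add: add_pos_nonneg less_imp_neq[symmetric])
    then show ?thesis using alpha_nonneg[of r] by (cases "alpha r = 0") auto
  qed
  have no_comm: "r \<notin> comm_times P Tc" if r: "s < r" "r < s + P" for r
  proof
    assume "r \<in> comm_times P Tc"
    then obtain j where "r = 1 + j * P" by (auto simp: comm_times_def)
    with r k have "k * P < j * P" "j * P < Suc k * P" by auto
    then have "k < j" "j < Suc k" using mult_less_cancel2 by blast+
    then show False by simp
  qed
  have same: "x l s = x i s"
  proof -
    \<comment> \<open>A communication time is at least \<open>1 + P \<ge> 2\<close>, so the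
      averaging step that produces \<open>s\<close> exists.\<close>
    have "s - 1 \<in> {1..T}" "s - 1 + 1 = s" using s2 t by auto
    then show ?thesis using x_step[of l "s - 1"] x_step[of i "s - 1"] il s by simp
  qed
  have drift: "norm (x j (s + n) - x j s) \<le> real n * (2 * u s)"
    if j: "j \<in> {1..m}" and n: "s + n \<le> t" for j n
    using n
  proof (induction n)
    case (Suc n)
    have "x j (s + n + 1) = y j (s + n + 1)"
      using x_step[OF j, of "s + n"] no_comm[of "s + n + 1"] Suc.prems t s2 by auto
    then have "norm (x j (s + Suc n) - x j (s + n)) \<le> 2 * u (s + n)"
      using step_le[OF j, of "s + n"] alpha_pos[of "s + n"] Suc.prems t s2 by simp
    also have "\<dots> \<le> 2 * u s" using alpha_lam_antimono[of s "s + n"] s2 by simp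
    finally have "norm (x j (s + Suc n) - x j (s + n)) \<le> 2 * u s" .
    moreover have "norm (x j (s + Suc n) - x j s)
        \<le> norm (x j (s + Suc n) - x j (s + n)) + norm (x j (s + n) - x j s)"
      using norm_triangle_ineq[of "x j (s + Suc n) - x j (s + n)" "x j (s + n) - x j s"] by simp
    moreover have "norm (x j (s + n) - x j s) \<le> real n * (2 * u s)"
      using Suc by simp
    ultimately show ?case by (simp add: algebra_simps)
  qed simp
  have us: "0 \<le> u s" using alpha_lam_nonneg[of s] s2 by simp
  have bound: "norm (x j t - x j s) \<le> real P * (2 * u s)" if "j \<in> {1..m}" for j
  proof -
    have "norm (x j t - x j s) \<le> real (t - s) * (2 * u s)"
      using drift[OF that, of "t - s"] t(1) by simp
    also have "\<dots> \<le> real P * (2 * u s)" using t us by (intro mult_right_mono) auto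
    finally show ?thesis .
  qed
  have "norm (x l t - x i t) \<le> norm (x l t - x l s) + norm (x i t - x i s)"
    using norm_triangle_ineq4[of "x l t - x l s" "x i t - x i s"] same by simp
  also have "\<dots> \<le> 4 * real P * u s"
    using bound[OF il(1)] bound[OF il(2)] by simp
  finally show ?thesis .
qed

definition "\<rho> = real m * (R1 + 10 * A)"

lemma sum_agents_le:
  fixes h :: "nat \<Rightarrow> real"
  assumes "\<And>i. i \<in> {1..m} \<Longrightarrow> h i \<le> K"
  shows "(\<Sum>i=1..m. h i) \<le> real m * K"
  using sum_bounded_above[of "{1..m}" h K] assms by simp

lemma R1_le_rho: "R1 \<le> \<rho>"
proof -
  have "1 * (R1 + 10 * A) \<le> \<rho>"
    unfolding \<rho>_def using m_pos R1_nonneg A_pos by (intro mult_right_mono) auto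
  then show ?thesis using A_pos by simp
qed

text \<open>\<open>Q\<close> exceeds \<open>2 L \<rho> + 2 B\<close> by \<open>2 m L R1\<close>.
  This pays for the way from an agent's initial point, where the gradient is at most
  \<open>B\<close>, to \<open>xstar\<close>.\<close>

lemma Q_ge_rho: "2 * L * \<rho> \<le> Q" "2 * (B + L * (\<rho> + R1)) \<le> Q"
proof -
  have "L * R1 \<le> real m * (L * R1)"
    using mult_right_mono[of 1 "real m" "L * R1"] m_pos L_nonneg R1_nonneg by simp
  moreover have "0 \<le> L * R1" using L_nonneg R1_nonneg by simp
  ultimately show "2 * L * \<rho> \<le> Q" "2 * (B + L * (\<rho> + R1)) \<le> Q"
    unfolding Q_eq \<rho>_def using B_nonneg by (auto simp: algebra_simps)
qed

section \<open>One induction step: consequences of the radius bound up to time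
  \<open>S\<close>\<close>

context
  fixes S
  assumes S: "S \<in> {1..T}"
    and radius: "\<And>i s. \<lbrakk>i \<in> {1..m}; s \<in> {1..S}\<rbrakk> \<Longrightarrow> sqrt (2 * D i s) \<le> \<rho>"
begin

lemma gradient_le:
  assumes "i \<in> {1..m}" "t \<in> {1..S}"
  shows "norm (gr i t) \<le> lam t / 2"
proof -
  have "norm (x i t - x i 1) \<le> norm (xstar - x i 1) + norm (xstar - x i t)"
    using norm_triangle_ineq4[of "xstar - x i 1" "xstar - x i t"] by simp
  also have "\<dots> \<le> R1 + \<rho>"
    using dist_le[of i 1] dist_le[of i t] D_init[of i] radius[of i t] assms S by auto
  finally have "L * norm (x i t - x i 1) \<le> L * (\<rho> + R1)"
    using L_nonneg by (intro mult_left_mono) auto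
  moreover have "norm (gr i t) \<le> norm (gr i 1) + norm (gr i t - gr i 1)"
    by (rule norm_triangle_sub)
  ultimately have "norm (gr i t) \<le> B + L * (\<rho> + R1)"
    using gr_init[of i] gr_lip[of i t] assms S by auto
  also have "\<dots> \<le> lam t / 2"
    using Q_ge_rho(2) lam_ge(3)[of t] assms by auto
  finally show ?thesis .
qed

text \<open>This is the purpose of the summand \<open>8 m\<close> of \<open>A\<close>: dividing by
  \<open>V t\<close> can absorb the numerical constants of the drift.\<close>

lemma V_ge_8m:
  assumes "t \<in> {1..S}"
  shows "8 * real m \<le> V t" "8 \<le> V t"
proof -
  have "A \<le> V t" using V_ge_A[of t] assms S by auto
  then show "8 * real m \<le> V t" using A_bounds(1) by linarith
  then show "8 \<le> V t" using m_pos by auto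
qed

lemma dist_xstar:
  assumes "i \<in> {1..m}" "t \<in> {1..S}"
  shows "norm (xstar - x i t) \<le> V t / (2 * real m)" "norm (xstar - x i t) \<le> \<rho>"
proof -
  have d: "norm (xstar - x i t) \<le> sqrt (2 * D i t)" using dist_le[of i t] assms S by auto
  then show "norm (xstar - x i t) \<le> \<rho>" using radius[OF assms] by linarith
  have "2 * real m * sqrt (2 * D i t) \<le> V t" using V_ge[of i t t] assms A_pos by auto
  then have "sqrt (2 * D i t) \<le> V t / (2 * real m)" using m_pos by (simp add: field_simps)
  with d show "norm (xstar - x i t) \<le> V t / (2 * real m)" by linarith
qed

lemma dist_pair:
  assumes "i \<in> {1..m}" "l \<in> {1..m}" "t \<in> {1..S}"
  shows "norm (x l t - x i t) \<le> V t / real m" "norm (x l t - x i t) \<le> 2 * \<rho>"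
proof -
  have "norm (x l t - x i t) \<le> norm (xstar - x i t) + norm (xstar - x l t)"
    using norm_triangle_ineq4[of "xstar - x i t" "xstar - x l t"] by simp
  then show "norm (x l t - x i t) \<le> V t / real m" "norm (x l t - x i t) \<le> 2 * \<rho>"
    using dist_xstar[of i t] dist_xstar[of l t] assms by auto
qed

text \<open>Before the first communication the iterates need not agree, because the initial points are
  arbitrary. There \<open>\<tau>(t) = 1\<close> and \<open>\<alpha>\<^sub>1\<lambda>\<^sub>1 = 1\<close>, so the summand of \<open>C\<^sub>1\<close> is \<open>\<alpha>\<^sub>t\<lambda>\<^sub>t\<close>,
  which dominates the crude bound obtained from the distances to \<open>x\<^sup>*\<close>.\<close>
lemma disagreement_le:
  assumes l: "l \<in> {1..m}" and t: "t \<in> {1..S}"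
  shows "alpha t / V t * (\<Sum>i=1..m. L * (norm (x l t - x i t))\<^sup>2)
      + alpha t / V t * (\<Sum>i=1..m. norm (gr i t) * norm (x i t - x l t))
    \<le> 2 * real m * L * (real P)\<^sup>2 * c0 t + 4 * real m * real P * c1 t"
proof (cases "Q = 0")
  \<comment> \<open>With \<open>1 / alpha t = 0\<close> the update no longer ties the next point to
    the current one, so no drift bound is available; instead the weights vanish.\<close>
  case True
  then show ?thesis by (simp add: alpha_Q0)
next
  case False
  then have Q: "0 < Q" using Q_nonneg by simp
  have t1: "1 \<le> t" "t \<le> T" using t S by auto
  have V: "8 * real m \<le> V t" "8 \<le> V t" using V_ge_8m[OF t] .
  have Vp: "0 < V t" using V by linarith
  have mp: "1 \<le> real m" "1 \<le> real P" using m_pos P_pos by auto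
  have av: "0 \<le> alpha t / V t" using alpha_nonneg[of t] Vp by simp
  note nn = c_nonneg[OF t1(1)]
  have lam0: "0 \<le> lam t" using lam_ge(1)[OF t1(1)] by simp
  have u0: "0 \<le> u t" using alpha_lam_nonneg[OF t1(1)] .
  \<comment> \<open>Two bounds for one distance: early on, the quadratic term needs one factor to
    cancel \<open>V t\<close> and another one that \<open>Q\<close> can pay for.\<close>
  have bound: "alpha t / V t * (\<Sum>i=1..m. L * (norm (x l t - x i t))\<^sup>2)
      + alpha t / V t * (\<Sum>i=1..m. norm (gr i t) * norm (x i t - x l t))
    \<le> alpha t / V t * (real m * (L * (b * b'))) + alpha t / V t * (real m * (lam t / 2 * b))"
    if b: "\<And>i. i \<in> {1..m} \<Longrightarrow> norm (x l t - x i t) \<le> b"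
      "\<And>i. i \<in> {1..m} \<Longrightarrow> norm (x l t - x i t) \<le> b'" for b b'
  proof (intro add_mono mult_left_mono[OF _ av] sum_agents_le)
    fix i assume i: "i \<in> {1..m}"
    show "L * (norm (x l t - x i t))\<^sup>2 \<le> L * (b * b')"
      unfolding power2_eq_square using b[OF i] L_nonneg order_trans[OF norm_ge_zero b(1)[OF i]]
      by (intro mult_left_mono mult_mono) auto
    show "norm (gr i t) * norm (x i t - x l t) \<le> lam t / 2 * b"
      using gradient_le[OF i t] b(1)[OF i] lam0 by (intro mult_mono) (auto simp: norm_minus_commute)
  qed
  show ?thesis
  proof (cases "t \<le> 1 + P")
    case True
    have c1: "c1 t = u t"
    proof -
      have "u 1 = 1" using alpha_lam[of 1] Q w_1 by simp
      moreover have "c1 t = u t * u 1" using True by (simp add: tau_first mult_ac)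
      ultimately show ?thesis by simp
    qed
    have "alpha t / V t * (\<Sum>i=1..m. L * (norm (x l t - x i t))\<^sup>2)
        + alpha t / V t * (\<Sum>i=1..m. norm (gr i t) * norm (x i t - x l t))
      \<le> alpha t / V t * (real m * (L * (V t / real m * (2 * \<rho>))))
        + alpha t / V t * (real m * (lam t / 2 * (V t / real m)))"
      by (intro bound dist_pair l t)
    also have "\<dots> = alpha t * (2 * L * \<rho>) + u t / 2"
      using Vp mp by (simp add: field_simps)
    \<comment> \<open>\<open>V t\<close> and \<open>m\<close> have cancelled, and
      \<open>2 L \<rho> \<le> Q \<le> lam t\<close> turns the quadratic term into
      \<open>u t\<close>.\<close>
    also have "\<dots> \<le> alpha t * lam t + u t / 2"
      using Q_ge_rho(1) lam_ge(3)[of t] alpha_nonneg[of t] by (intro add_right_mono mult_left_mono) auto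
    also have "\<dots> \<le> 4 * (1 * 1) * u t" using u0 by simp
    also have "\<dots> \<le> 4 * (real m * real P) * u t"
      using mp u0 by (intro mult_right_mono mult_left_mono mult_mono) auto
    also have "\<dots> \<le> 2 * real m * L * (real P)\<^sup>2 * c0 t + 4 * real m * real P * c1 t"
      using nn(1) L_nonneg unfolding c1 by simp
    finally show ?thesis .
  next
    case False
    then obtain k where k: "1 \<le> k" "tau P t = 1 + k * P" "1 + k * P \<le> t" "t < 1 + k * P + P"
      using tau_eq[OF P_pos, of t] not_le by blast
    define s where "s = tau P t"
    \<comment> \<open>\<open>tau\<close> knows no last round; \<open>t \<le> T\<close> makes its
      value a genuine communication time.\<close>
    have "k * P \<le> Tc * P" using k(3) t1(2) unfolding T_eq by linarith
    then have "k \<le> Tc" using P_pos by simp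
    then have s: "s \<in> comm_times P Tc" using k unfolding s_def comm_times_def by auto
    have us: "0 \<le> u s" unfolding s_def by (rule alpha_lam_nonneg[OF tau_ge_1[OF P_pos]])
    have "alpha t / V t * (\<Sum>i=1..m. L * (norm (x l t - x i t))\<^sup>2)
        + alpha t / V t * (\<Sum>i=1..m. norm (gr i t) * norm (x i t - x l t))
      \<le> alpha t / V t * (real m * (L * (4 * real P * u s * (4 * real P * u s))))
        + alpha t / V t * (real m * (lam t / 2 * (4 * real P * u s)))"
      using k t1 s l Q unfolding s_def by (intro bound consensus) auto
    \<comment> \<open>With \<open>8 / V t \<le> 1\<close> split off, the squared drift constant 16
      leaves 2.\<close>
    also have "\<dots> = (2 * real m * L * (real P)\<^sup>2 * (alpha t * (u s)\<^sup>2)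
        + real m * real P / 4 * (u t * u s)) * (8 / V t)"
      using Vp by (simp add: field_simps power2_eq_square)
    also have "\<dots> \<le> (2 * real m * L * (real P)\<^sup>2 * (alpha t * (u s)\<^sup>2)
        + real m * real P / 4 * (u t * u s)) * 1"
      using V u0 us alpha_nonneg[of t] L_nonneg by (intro mult_left_mono) auto
    also have "\<dots> \<le> 2 * real m * L * (real P)\<^sup>2 * (alpha t * (u s)\<^sup>2)
        + 4 * real m * real P * (u t * u s)"
      unfolding mult_1_right
      by (intro add_left_mono mult_right_mono mult_nonneg_nonneg[OF u0 us]) (use mp in simp)
    also have "\<dots> = 2 * real m * L * (real P)\<^sup>2 * c0 t + 4 * real m * real P * c1 t"
      by (simp add: s_def power_mult_distrib mult_ac)
    finally show ?thesis .
  qed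
qed

text \<open>In the first bound the distance \<open>V t / (2 m)\<close> cancels the weight, the
  number of agents and the constant 2 of the bias. In the last one
  \<open>alpha^2 lam^(2-p) = u^2 lam^(-p)\<close> produces \<open>c4\<close>, and two more powers of
  \<open>u\<close> produce \<open>c5\<close>.\<close>

lemma noise_le:
  assumes t: "t \<in> {1..S}"
  shows "alpha t / V t * (\<Sum>i=1..m. tb i t \<bullet> (xstar - x i t)) \<le> \<sigma> powr p * c2 t"
    and "(alpha t)\<^sup>2 / V t * (\<Sum>i=1..m. (norm (tb i t))\<^sup>2) \<le> 4 * real m * \<sigma> powr (2 * p) * c3 t"
    and "((alpha t)\<^sup>2 / V t + 3 * real m * (alpha t)\<^sup>2 + 6 * (alpha t)^4 * (lam t)\<^sup>2 * real m / (V t)\<^sup>2)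
        * (\<Sum>i=1..m. vu i t)
      \<le> 24 * real m * \<sigma> powr p * (1 + 3 * real m) * c4 t + 3 * (real m)\<^sup>2 * \<sigma> powr p * c5 t"
proof -
  define s where "s = \<sigma> powr p"
  have s: "0 \<le> s" by (simp add: s_def)
  have t1: "1 \<le> t" "t \<le> T" using t S by auto
  have V: "8 \<le> V t" using V_ge_8m[OF t] by simp
  have Vp: "0 < V t" using V by linarith
  have mp: "1 \<le> real m" using m_pos by auto
  have lam1: "1 \<le> lam t" using lam_ge(1)[OF t1(1)] .
  have a0: "0 \<le> alpha t" by (rule alpha_nonneg)
  note nn = c_nonneg[OF t1(1)]
  have tb: "norm (tb i t) \<le> 2 * s * lam t powr (1 - p)"
    and vu: "vu i t \<le> 24 * s * lam t powr (2 - p)" if "i \<in> {1..m}" for i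
    using tb_le[OF that] vu_le[OF that] gradient_le[OF that t] t1 by (auto simp: s_def)
  have "alpha t / V t * (\<Sum>i=1..m. tb i t \<bullet> (xstar - x i t))
      \<le> alpha t / V t * (real m * (2 * s * lam t powr (1 - p) * (V t / (2 * real m))))"
  proof (intro mult_left_mono sum_agents_le)
    fix i assume i: "i \<in> {1..m}"
    have "tb i t \<bullet> (xstar - x i t) \<le> norm (tb i t) * norm (xstar - x i t)"
      by (rule norm_cauchy_schwarz)
    also have "\<dots> \<le> 2 * s * lam t powr (1 - p) * (V t / (2 * real m))"
      using tb[OF i] dist_xstar(1)[OF i t] s by (intro mult_mono) auto
    finally show "tb i t \<bullet> (xstar - x i t) \<le> 2 * s * lam t powr (1 - p) * (V t / (2 * real m))" .
  qed (use a0 Vp in auto)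
  also have "\<dots> = s * c2 t" using Vp mp by (simp add: field_simps)
  finally show "alpha t / V t * (\<Sum>i=1..m. tb i t \<bullet> (xstar - x i t)) \<le> \<sigma> powr p * c2 t"
    by (simp add: s_def)

  have "(alpha t)\<^sup>2 / V t * (\<Sum>i=1..m. (norm (tb i t))\<^sup>2)
      \<le> (alpha t)\<^sup>2 / 1 * (real m * (2 * s * lam t powr (1 - p))\<^sup>2)"
    using V a0 s tb by (intro mult_mono divide_left_mono sum_agents_le power_mono sum_nonneg) auto
  also have "\<dots> = 4 * real m * s\<^sup>2 * c3 t"
    using powr_add[of "lam t" "1 - p" "1 - p"] by (simp add: power2_eq_square)
  also have "s\<^sup>2 = \<sigma> powr (2 * p)"
    by (simp add: s_def power2_eq_square powr_add[symmetric])
  finally show "(alpha t)\<^sup>2 / V t * (\<Sum>i=1..m. (norm (tb i t))\<^sup>2) \<le> 4 * real m * \<sigma> powr (2 * p) * c3 t" .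

  define z where "z = lam t powr (- p)"
  have z: "0 \<le> z" by (simp add: z_def)
  have lz: "lam t powr (2 - p) = (lam t)\<^sup>2 * z"
    using lam1 powr_add[of "lam t" 2 "- p"] by (simp add: z_def powr_numeral)
  have V2: "64 \<le> (V t)\<^sup>2" using V power_mono[of 8 "V t" 2] by simp
  have "((alpha t)\<^sup>2 / V t + 3 * real m * (alpha t)\<^sup>2 + 6 * (alpha t)^4 * (lam t)\<^sup>2 * real m / (V t)\<^sup>2)
        * (\<Sum>i=1..m. vu i t)
      \<le> ((alpha t)\<^sup>2 / V t + 3 * real m * (alpha t)\<^sup>2 + 6 * (alpha t)^4 * (lam t)\<^sup>2 * real m / (V t)\<^sup>2)
        * (real m * (24 * s * lam t powr (2 - p)))"
    using Vp vu by (intro mult_left_mono sum_agents_le) auto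
  also have "\<dots> \<le> ((alpha t)\<^sup>2 / 1 + 3 * real m * (alpha t)\<^sup>2 + 6 * (alpha t)^4 * (lam t)\<^sup>2 * real m / 64)
        * (real m * (24 * s * lam t powr (2 - p)))"
    using Vp V V2 s by (intro mult_right_mono add_mono divide_left_mono order_refl) auto
  \<comment> \<open>\<open>9 / 4 = 6 * 24 / 64\<close>, with 64 from the lower bound 8 on
    \<open>V t\<close>.\<close>
  also have "\<dots> = 24 * real m * s * (1 + 3 * real m) * c4 t + 9 / 4 * ((real m)\<^sup>2 * s * c5 t)"
    unfolding lz z_def[symmetric] by (simp add: field_simps power2_eq_square power4_eq_xxxx)
  also have "\<dots> \<le> 24 * real m * s * (1 + 3 * real m) * c4 t + 3 * ((real m)\<^sup>2 * s * c5 t)"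
    using nn(6) s by (intro add_left_mono mult_right_mono) auto
  finally show "((alpha t)\<^sup>2 / V t + 3 * real m * (alpha t)\<^sup>2 + 6 * (alpha t)^4 * (lam t)\<^sup>2 * real m / (V t)\<^sup>2)
        * (\<Sum>i=1..m. vu i t)
      \<le> 24 * real m * \<sigma> powr p * (1 + 3 * real m) * c4 t + 3 * (real m)\<^sup>2 * \<sigma> powr p * c5 t"
    by (simp add: s_def mult.assoc)
qed

text \<open>In \<open>2 D = sqrt (2 D) * sqrt (2 D)\<close> one root is at most \<open>R1\<close>,
  the other at most \<open>V 1 / (2 m)\<close>; summation over the agents then cancels
  \<open>m\<close> and \<open>V 1\<close>.\<close>

lemma initial_le: "1 / V 1 * (\<Sum>i=1..m. D i 1) \<le> R1 / 4"
proof -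
  have V: "8 * real m \<le> V 1" "8 \<le> V 1" using V_ge_8m[of 1] S by auto
  have mp: "1 \<le> real m" using m_pos by auto
  have "D i 1 \<le> R1 * (V 1 / (4 * real m))" if i: "i \<in> {1..m}" for i
  proof -
    have D0: "0 \<le> D i 1" using D_nonneg[of i 1] i by simp
    have "2 * real m * sqrt (2 * D i 1) \<le> V 1" using V_ge[OF i, of 1 1] A_pos by simp
    then have "sqrt (2 * D i 1) \<le> V 1 / (2 * real m)" using mp by (simp add: field_simps)
    then have "sqrt (2 * D i 1) * sqrt (2 * D i 1) \<le> R1 * (V 1 / (2 * real m))"
      using D_init[OF i] R1_nonneg D0 by (intro mult_mono) auto
    then show ?thesis using D0 by simp
  qed
  then have "(\<Sum>i=1..m. D i 1) \<le> real m * (R1 * (V 1 / (4 * real m)))"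
    by (rule sum_agents_le)
  also have "\<dots> = R1 / 4 * V 1" using mp by simp
  finally show ?thesis using V by (simp add: field_simps)
qed

text \<open>Each error is charged to its summand of \<open>A\<close>. The disagreement, bounded by
  \<open>2 a1 + 4 a2\<close>, may take twice its share \<open>a1 + 2 a2\<close>, and every other
  term stays within its own; hence \<open>2 A\<close>.\<close>

lemma error_terms_le:
  assumes l: "l \<in> {1..m}"
  shows "(\<Sum>t=1..S. alpha t / V t * gap l t) + 1 / V S * (\<Sum>i=1..m. D i (S + 1)) \<le> R1 / 4 + 2 * A"
proof -
  note disagreement = disagreement_le[OF l]
  have "(\<Sum>t=1..S. alpha t / V t * (\<Sum>i=1..m. L * (norm (x l t - x i t))\<^sup>2))
      + (\<Sum>t=1..S. alpha t / V t * (\<Sum>i=1..m. norm (gr i t) * norm (x i t - x l t)))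
    \<le> (\<Sum>t=1..S. 2 * real m * L * (real P)\<^sup>2 * c0 t + 4 * real m * real P * c1 t)"
    unfolding sum.distrib[symmetric] by (intro sum_mono disagreement)
  moreover have "(\<Sum>t=1..S. alpha t / V t * (\<Sum>i=1..m. tb i t \<bullet> (xstar - x i t)))
      \<le> (\<Sum>t=1..S. \<sigma> powr p * c2 t)"
    by (intro sum_mono noise_le)
  moreover have "(\<Sum>t=1..S. (alpha t)\<^sup>2 / V t * (\<Sum>i=1..m. (norm (tb i t))\<^sup>2))
      \<le> (\<Sum>t=1..S. 4 * real m * \<sigma> powr (2 * p) * c3 t)"
    by (intro sum_mono noise_le)
  moreover have "(\<Sum>t=1..S. ((alpha t)\<^sup>2 / V t + 3 * real m * (alpha t)\<^sup>2
        + 6 * (alpha t)^4 * (lam t)\<^sup>2 * real m / (V t)\<^sup>2) * (\<Sum>i=1..m. vu i t))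
      \<le> (\<Sum>t=1..S. 24 * real m * \<sigma> powr p * (1 + 3 * real m) * c4 t + 3 * (real m)\<^sup>2 * \<sigma> powr p * c5 t)"
    by (intro sum_mono noise_le)
  moreover define a1 where "a1 = real m * L * (real P)\<^sup>2 * (\<Sum>t=1..S. c0 t)"
  moreover define a2 where "a2 = real m * real P * (\<Sum>t=1..S. c1 t)"
  moreover define a3 where "a3 = \<sigma> powr p * (\<Sum>t=1..S. c2 t)"
  moreover define a4 where "a4 = real m * \<sigma> powr (2 * p) * (\<Sum>t=1..S. c3 t)"
  moreover define a5 where "a5 = real m * \<sigma> powr p * (1 + 3 * real m) * (\<Sum>t=1..S. c4 t)"
  moreover define a6 where "a6 = (real m)\<^sup>2 * \<sigma> powr p * (\<Sum>t=1..S. c5 t)"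
  moreover have "0 \<le> a1" "0 \<le> a2" "0 \<le> a3" "0 \<le> a4" "0 \<le> a5" "0 \<le> a6"
  proof -
    have "0 \<le> (\<Sum>t=1..S. c0 t)" "0 \<le> (\<Sum>t=1..S. c1 t)" "0 \<le> (\<Sum>t=1..S. c2 t)"
      "0 \<le> (\<Sum>t=1..S. c3 t)" "0 \<le> (\<Sum>t=1..S. c4 t)" "0 \<le> (\<Sum>t=1..S. c5 t)"
      by (intro sum_nonneg c_nonneg; simp)+
    then show "0 \<le> a1" "0 \<le> a2" "0 \<le> a3" "0 \<le> a4" "0 \<le> a5" "0 \<le> a6"
      unfolding a1_def a2_def a3_def a4_def a5_def a6_def using L_nonneg by simp_all
  qed
  moreover have "0 \<le> ln (1 / \<delta>)" using delta by simp
  moreover have "ln (1 / \<delta>) + a1 + 2 * a2 + 4 * a3 + 16 * a4 + 40 * a5 + 40 * a6 \<le> A"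
    using A_bounds(2)[of S] by (simp add: a1_def a2_def a3_def a4_def a5_def a6_def mult.assoc)
  moreover have "(\<Sum>t=1..S. 2 * real m * L * (real P)\<^sup>2 * c0 t + 4 * real m * real P * c1 t) = 2 * a1 + 4 * a2"
    "(\<Sum>t=1..S. \<sigma> powr p * c2 t) = a3"
    "(\<Sum>t=1..S. 4 * real m * \<sigma> powr (2 * p) * c3 t) = 4 * a4"
    "(\<Sum>t=1..S. 24 * real m * \<sigma> powr p * (1 + 3 * real m) * c4 t + 3 * (real m)\<^sup>2 * \<sigma> powr p * c5 t)
      = 24 * a5 + 3 * a6"
    unfolding a1_def a2_def a3_def a4_def a5_def a6_def sum.distrib sum_distrib_left[symmetric]
    by (simp_all add: mult.assoc)
  ultimately show ?thesis using event[OF l S] initial_le by linarith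
qed

lemma path_step:
  assumes l: "l \<in> {1..m}"
  shows "(\<Sum>t=1..S. alpha t * gap l t) + (\<Sum>i=1..m. D i (S + 1)) \<le> \<rho>\<^sup>2 / 2"
proof -
  have VS: "8 \<le> V S" using V_ge_8m[of S] S by auto
  have mp: "1 \<le> real m" using m_pos by auto
  \<comment> \<open>Nonnegative gaps and the monotonicity of \<open>V\<close> allow all weights
    \<open>1 / V t\<close> to be lowered to \<open>1 / V S\<close>.\<close>
  have "alpha t * gap l t \<le> V S * (alpha t / V t * gap l t)" if t: "t \<in> {1..S}" for t
  proof -
    have V: "8 \<le> V t" using V_ge_8m[OF t] by auto
    have g: "0 \<le> alpha t * gap l t" using gap_nonneg[OF l, of t] alpha_nonneg[of t] t S by auto
    have "1 \<le> V S / V t" using V_mono[of t S] V t by simp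
    then have "1 * (alpha t * gap l t) \<le> V S / V t * (alpha t * gap l t)"
      using g by (intro mult_right_mono)
    then show ?thesis by (simp add: mult_ac)
  qed
  then have "(\<Sum>t=1..S. alpha t * gap l t) \<le> V S * (\<Sum>t=1..S. alpha t / V t * gap l t)"
    unfolding sum_distrib_left by (intro sum_mono)
  moreover have "(\<Sum>i=1..m. D i (S + 1)) = V S * (1 / V S * (\<Sum>i=1..m. D i (S + 1)))"
    using VS by simp
  ultimately have "(\<Sum>t=1..S. alpha t * gap l t) + (\<Sum>i=1..m. D i (S + 1))
      \<le> V S * ((\<Sum>t=1..S. alpha t / V t * gap l t) + 1 / V S * (\<Sum>i=1..m. D i (S + 1)))"
    by (simp only: distrib_left)
  also have "\<dots> \<le> V S * (R1 / 4 + 2 * A)"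
    using error_terms_le[OF l] VS by (intro mult_left_mono) auto
  also have "\<dots> \<le> (2 * real m * \<rho> + A) * (R1 / 4 + 2 * A)"
    using V_le[of S \<rho>] radius S R1_nonneg A_pos by (intro mult_right_mono) auto
  also have "\<dots> \<le> ((real m)\<^sup>2 * (2 * R1 + 21 * A)) * (R1 / 4 + 2 * A)"
  proof (intro mult_right_mono)
    have "1 * 1 \<le> real m * real m" using mp by (intro mult_mono) auto
    then have "1 * A \<le> (real m)\<^sup>2 * A"
      using A_pos by (intro mult_right_mono) (auto simp: power2_eq_square)
    then show "2 * real m * \<rho> + A \<le> (real m)\<^sup>2 * (2 * R1 + 21 * A)"
      by (simp add: \<rho>_def algebra_simps power2_eq_square)
  qed (use R1_nonneg A_pos in auto)
  also have "\<dots> = (real m)\<^sup>2 * ((2 * R1 + 21 * A) * (R1 / 4 + 2 * A))" by (simp only: mult.assoc)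
  \<comment> \<open>Left \<open>R1^2/2 + 37/4 R1 A + 42 A^2\<close>, right
    \<open>R1^2/2 + 10 R1 A + 50 A^2\<close>: the first coefficient is tight, and the 10 in the
    radius makes room for the others.\<close>
  also have "\<dots> \<le> (real m)\<^sup>2 * ((R1 + 10 * A)\<^sup>2 / 2)"
  proof (intro mult_left_mono)
    have "0 \<le> R1 * A" "0 \<le> A * A" using R1_nonneg A_pos by auto
    then show "(2 * R1 + 21 * A) * (R1 / 4 + 2 * A) \<le> (R1 + 10 * A)\<^sup>2 / 2"
      by (simp add: algebra_simps power2_eq_square)
  qed simp
  also have "\<dots> = \<rho>\<^sup>2 / 2" by (simp add: \<rho>_def power_mult_distrib)
  finally show ?thesis .
qed

end

section \<open>Closing the induction over time\<close>

lemma radius_le: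
  assumes "s \<in> {1..T + 1}" "i \<in> {1..m}"
  shows "sqrt (2 * D i s) \<le> \<rho>"
  using assms
proof (induction s arbitrary: i rule: less_induct)
  case (less s)
  show ?case
  proof (cases "s = 1")
    case True
    then show ?thesis using D_init[OF less.prems(2)] R1_le_rho by simp
  next
    case False
    define S where "S = s - 1"
    have S: "S \<in> {1..T}" "s = S + 1" using False less.prems by (auto simp: S_def)
    have one: "1 \<in> {1..m}" using m_pos by simp
    have "D i (S + 1) \<le> (\<Sum>i=1..m. D i (S + 1))"
      using less.prems S D_nonneg by (intro member_le_sum) auto
    \<comment> \<open>The gaps of any one agent will do here; they are nonnegative because
      \<open>xstar\<close> is a minimizer.\<close>
    also have "\<dots> \<le> (\<Sum>t=1..S. alpha t * gap 1 t) + (\<Sum>i=1..m. D i (S + 1))"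
    proof -
      have "0 \<le> (\<Sum>t=1..S. alpha t * gap 1 t)"
        by (intro sum_nonneg mult_nonneg_nonneg alpha_nonneg gap_nonneg one) (use S in auto)
      then show ?thesis by linarith
    qed
    also have "\<dots> \<le> \<rho>\<^sup>2 / 2"
      using less.IH S by (intro path_step one) auto
    finally have "2 * D i s \<le> \<rho>\<^sup>2" unfolding S(2) by simp
    moreover have "0 \<le> \<rho>" using R1_nonneg R1_le_rho by linarith
    ultimately show ?thesis by (rule real_le_lsqrt[rotated])
  qed
qed

lemma path_bound:
  assumes "S \<in> {1..T}" "l \<in> {1..m}"
  shows "(\<Sum>t=1..S. alpha t * gap l t) + (\<Sum>i=1..m. D i (S + 1)) \<le> (real m)\<^sup>2 * (R1 + 10 * A)\<^sup>2"
proof -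
  have "(\<Sum>t=1..S. alpha t * gap l t) + (\<Sum>i=1..m. D i (S + 1)) \<le> \<rho>\<^sup>2 / 2"
    using assms radius_le by (intro path_step) auto
  also have "\<dots> \<le> \<rho>\<^sup>2" by simp
  finally show ?thesis by (simp add: \<rho>_def power_mult_distrib)
qed

end

subsection \<open>The algorithm\<close>

lemma subalgebra_filt:
  assumes "\<And>i s. \<lbrakk>i \<in> {1..m}; s \<in> {1..t}\<rbrakk> \<Longrightarrow> G i s \<in> borel_measurable M"
  shows "subalgebra M (filt M G m t)"
proof -
  let ?A = "{G i s -` B \<inter> space M | i s B. i \<in> {1..m} \<and> s \<in> {1..t} \<and> B \<in> sets borel}"
  have "?A \<subseteq> Pow (space M)" by auto
  then have "sets (filt M G m t) = sigma_sets (space M) ?A"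
    unfolding filt_def by (rule sets_measure_of)
  also have "\<dots> \<subseteq> sets M"
    by (rule sets.sigma_sets_subset) (use assms in \<open>auto intro: measurable_sets\<close>)
  finally show ?thesis by (simp add: subalgebra_def filt_def space_measure_of_conv)
qed

text \<open>The gradient map is controlled only on \<open>X\<close>, so it is measurable on the
  restricted Borel space, in which the iterates take their values.\<close>

lemma Lipschitz_comp_measurable:
  fixes g :: "real^'n \<Rightarrow> real^'n" and x :: "'a \<Rightarrow> real^'n"
  assumes "0 \<le> L" "\<And>u v. \<lbrakk>u \<in> X; v \<in> X\<rbrakk> \<Longrightarrow> norm (g u - g v) \<le> L * norm (u - v)"
    and x: "x \<in> borel_measurable F" "\<And>\<omega>. \<omega> \<in> space F \<Longrightarrow> x \<omega> \<in> X"
  shows "(\<lambda>\<omega>. g (x \<omega>)) \<in> borel_measurable F"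
proof (rule measurable_compose[where f = x and g = g and N = "restrict_space borel X"])
  have "L-lipschitz_on X g" using assms by (intro lipschitz_onI) (auto simp: dist_norm)
  then show "g \<in> borel_measurable (restrict_space borel X)"
    by (intro borel_measurable_continuous_on_restrict lipschitz_on_continuous_on)
  show "x \<in> measurable F (restrict_space borel X)"
    using x by (intro measurable_restrict_space2) auto
qed

theorem theorem1:
  fixes M :: "'a measure"
    and X :: "(real^'n) set"
    and f :: "nat \<Rightarrow> real^'n \<Rightarrow> real" and gf :: "nat \<Rightarrow> real^'n \<Rightarrow> real^'n"
    and Phi :: "real^'n \<Rightarrow> real" and gPhi :: "real^'n \<Rightarrow> real^'n"
    and xstar :: "real^'n" and x1 :: "nat \<Rightarrow> real^'n"
    and G x y :: "nat \<Rightarrow> nat \<Rightarrow> 'a \<Rightarrow> real^'n"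
    and m P Tc T :: nat
    and \<delta> p \<sigma> \<kappa> \<mu> \<gamma> L A R1 B :: real
    and alpha lam :: "nat \<Rightarrow> real"
  assumes m_pos: "m \<ge> 1" and P_pos: "P \<ge> 1" and Tc_pos: "Tc \<ge> 1"
    and T_def: "T = 1 + Tc * P"
    \<comment> \<open>the feasible set\<close>
    and X_ne: "X \<noteq> {}" and X_closed: "closed X" and X_convex: "convex X"
    \<comment> \<open>local objectives: convex, differentiable, gradient gf i\<close>
    and f_convex: "\<forall>i\<in>{1..m}. convex_on X (f i)"
    and f_diff: "\<forall>i\<in>{1..m}. \<forall>z\<in>X. (f i has_derivative (\<lambda>h. gf i z \<bullet> h)) (at z within X)"
    and xstar_X: "xstar \<in> X"
    and xstar_min: "\<forall>z\<in>X. (\<Sum>i=1..m. f i xstar) \<le> (\<Sum>i=1..m. f i z)"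
    \<comment> \<open>mirror map: differentiable, 1-strongly convex\<close>
    and Phi_diff: "\<forall>z\<in>X. (Phi has_derivative (\<lambda>h. gPhi z \<bullet> h)) (at z within X)"
    and Phi_sc: "\<forall>u\<in>X. \<forall>v\<in>X. Phi u - Phi v \<ge> gPhi v \<bullet> (u - v) + 1/2 * (norm (u - v))\<^sup>2"
    \<comment> \<open>(A2)\<close>
    and A2: "\<forall>i\<in>{1..m}. \<forall>u\<in>X. \<forall>v\<in>X. norm (gf i u - gf i v) \<le> L * norm (u - v)"
    \<comment> \<open>(A3)\<close>
    and A3: "\<forall>u\<in>X. \<forall>(J::nat set) a ys. finite J \<and> (\<forall>j\<in>J. ys j \<in> X \<and> a j \<ge> 0) \<and> sum a J = 1 \<longrightarrow>
               bregman Phi gPhi u (\<Sum>j\<in>J. a j *\<^sub>R ys j) \<le> (\<Sum>j\<in>J. a j * bregman Phi gPhi u (ys j))"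
    \<comment> \<open>probability space and stochastic gradients G i t = hat-nabla f_i(x_{i,t})\<close>
    and M_prob: "prob_space M"
    and G_meas: "\<forall>i\<in>{1..m}. \<forall>t\<in>{1..T}. G i t \<in> borel_measurable M"
    and x_adapted: "\<forall>i\<in>{1..m}. \<forall>t\<in>{1..T}. x i t \<in> borel_measurable (filt M G m (t - 1))"
    \<comment> \<open>(A1)\<close>
    and sigma_pos: "\<sigma> > 0" and p_gt: "1 < p" and p_le: "p \<le> 2"
    and G_int: "\<forall>i\<in>{1..m}. \<forall>t\<in>{1..T}. \<forall>j. integrable M (\<lambda>\<omega>. G i t \<omega> $ j)"
    and A1_unbiased: "\<forall>i\<in>{1..m}. \<forall>t\<in>{1..T}.
        AE \<omega> in M. vcond_exp M (filt M G m (t - 1)) (G i t) \<omega> = gf i (x i t \<omega>)"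
    and A1_moment: "\<forall>i\<in>{1..m}. \<forall>t\<in>{1..T}.
        AE \<omega> in M. nn_cond_exp M (filt M G m (t - 1))
            (\<lambda>\<eta>. ennreal ((norm (G i t \<eta> - gf i (x i t \<eta>))) powr p)) \<omega> \<le> ennreal (\<sigma> powr p)"
    \<comment> \<open>the algorithm (Clipped FedSMD)\<close>
    and x1_X: "\<forall>i\<in>{1..m}. x1 i \<in> X"
    and x_init: "\<forall>i\<in>{1..m}. \<forall>\<omega>\<in>space M. x i 1 \<omega> = x1 i"
    and y_step: "\<forall>i\<in>{1..m}. \<forall>t\<in>{1..T}. \<forall>\<omega>\<in>space M. y i (t + 1) \<omega> \<in> X \<and>
        (\<forall>z\<in>X. clip (lam t) (G i t \<omega>) \<bullet> y i (t + 1) \<omega>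
                   + 1 / alpha t * bregman Phi gPhi (y i (t + 1) \<omega>) (x i t \<omega>)
                 \<le> clip (lam t) (G i t \<omega>) \<bullet> z + 1 / alpha t * bregman Phi gPhi z (x i t \<omega>))"
    and x_step: "\<forall>i\<in>{1..m}. \<forall>t\<in>{1..T}. \<forall>\<omega>\<in>space M. x i (t + 1) \<omega> =
        (if t + 1 \<in> comm_times P Tc then (1 / real m) *\<^sub>R (\<Sum>j=1..m. y j (t + 1) \<omega>)
         else y i (t + 1) \<omega>)"
    \<comment> \<open>parameters\<close>
    and delta_pos: "0 < \<delta>" and delta_lt: "\<delta> < 1"
    and kappa_pos: "0 < \<kappa>" and kappa_lt: "\<kappa> < 1"
    and mu_pos: "0 < \<mu>" and mu_lt: "\<mu> < 1"
    and kappa_ge: "\<kappa> \<ge> max (\<mu> + 1/2) (1 - \<mu> * (p - 1))"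
    and gamma_gt: "\<gamma> > 1"
    and R1_bound: "\<forall>i\<in>{1..m}. sqrt (2 * bregman Phi gPhi xstar (x1 i)) \<le> R1"
    and B_def: "B = Max ((\<lambda>i. norm (gf i (x1 i))) ` {1..m})"
    and A_pos: "A > 0"
    and alpha_def: "alpha = (\<lambda>t. 1 / ((1 + ln (real t)) powr \<gamma> * real t powr (\<kappa> - \<mu>))
        * min (1 / real t powr \<mu>) (1 / (2 * real m * L * (2 * R1 + 10 * A) + 2 * B)))"
    and lam_def: "lam = (\<lambda>t. max (real t powr \<mu>) (2 * real m * L * (2 * R1 + 10 * A) + 2 * B))"
    and A_eq: "A = ln (1 / \<delta>)
        + real m * L * (real P)\<^sup>2 * (\<Sum>t. alpha (Suc t) * (alpha (tau P (Suc t)))\<^sup>2 * (lam (tau P (Suc t)))\<^sup>2)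
        + 2 * real m * real P * (\<Sum>t. alpha (Suc t) * alpha (tau P (Suc t)) * lam (Suc t) * lam (tau P (Suc t)))
        + 4 * \<sigma> powr p * (\<Sum>t. alpha (Suc t) * lam (Suc t) powr (1 - p))
        + 16 * real m * \<sigma> powr (2 * p) * (\<Sum>t. (alpha (Suc t))\<^sup>2 * lam (Suc t) powr (2 - 2 * p))
        + 40 * real m * \<sigma> powr p * (1 + 3 * real m) * (\<Sum>t. (alpha (Suc t) * lam (Suc t))\<^sup>2 * lam (Suc t) powr (- p))
        + 40 * (real m)\<^sup>2 * \<sigma> powr p * (\<Sum>t. (alpha (Suc t) * lam (Suc t)) ^ 4 * lam (Suc t) powr (- p))
        + 8 * real m"
  shows "AE \<omega> in M. event_E M G Phi gPhi f gf x xstar m T L alpha lam A \<delta> \<omega> \<longrightarrow>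
    (\<forall>K\<in>{1..T}. (\<forall>i\<in>{1..m}. \<forall>t\<in>{1..K - 1}. norm (gf i (x i t \<omega>)) \<le> lam t / 2) \<longrightarrow>
      (\<forall>l\<in>{1..m}. \<forall>S\<in>{1..K}.
         (\<Sum>t=1..S. alpha t * ((\<Sum>i=1..m. f i (x l t \<omega>)) - (\<Sum>i=1..m. f i xstar)))
         + (\<Sum>i=1..m. bregman Phi gPhi xstar (x i (S + 1) \<omega>))
         \<le> (real m)\<^sup>2 * (R1 + 10 * A)\<^sup>2))"
proof -
  have bregman_ge: "1/2 * (norm (u - v))\<^sup>2 \<le> bregman Phi gPhi u v" if "u \<in> X" "v \<in> X" for u v
    using Phi_sc[rule_format, OF that] by (simp add: bregman_def)
  have x_X: "x i t \<omega> \<in> X" if "i \<in> {1..m}" "t \<in> {1..T + 1}" "\<omega> \<in> space M" for i t \<omega>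
  proof (cases "t = 1")
    case True
    then show ?thesis using x_init x1_X that by auto
  next
    case False
    then have t: "t - 1 \<in> {1..T}" "t - 1 + 1 = t" using that by auto
    have y_X: "y j t \<omega> \<in> X" if "j \<in> {1..m}" for j
      using y_step t \<open>\<omega> \<in> space M\<close> that by metis
    have "(\<Sum>j=1..m. (1 / real m) *\<^sub>R y j t \<omega>) \<in> X"
      using y_X m_pos by (intro convex_sum X_convex) auto
    then have "(1 / real m) *\<^sub>R (\<Sum>j=1..m. y j t \<omega>) \<in> X" by (simp add: scaleR_sum_right)
    moreover have "x i t \<omega> = (if t \<in> comm_times P Tc
        then (1 / real m) *\<^sub>R (\<Sum>j=1..m. y j t \<omega>) else y i t \<omega>)"
      using x_step t that by metis
    ultimately show ?thesis using y_X that by simp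
  qed
  show ?thesis
  proof (cases "0 \<le> L")
    case False
    \<comment> \<open>A negative Lipschitz constant is only possible if \<open>X\<close> is a single point.\<close>
    have "u = v" if "u \<in> X" "v \<in> X" for u v
    proof (rule ccontr)
      assume "u \<noteq> v"
      then have "L * norm (u - v) < 0" using False by (simp add: mult_neg_pos)
      moreover have "norm (gf 1 u - gf 1 v) \<le> L * norm (u - v)" using A2 m_pos that by auto
      ultimately show False using norm_ge_zero[of "gf 1 u - gf 1 v"] by linarith
    qed
    then have "x i t \<omega> = xstar" if "i \<in> {1..m}" "t \<in> {1..T + 1}" "\<omega> \<in> space M" for i t \<omega>
      using x_X[OF that] xstar_X by blast
    then show ?thesis by (intro AE_I2) (auto simp: bregman_def)
  next
    case L: True
    define Q where "Q = 2 * real m * L * (2 * R1 + 10 * A) + 2 * B"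
    have one: "1 \<in> {1..m}" using m_pos by simp
    have "0 \<le> 1/2 * (norm (xstar - x1 1))\<^sup>2" by simp
    also have "\<dots> \<le> bregman Phi gPhi xstar (x1 1)"
      using bregman_ge[OF xstar_X] x1_X one by blast
    finally have "0 \<le> bregman Phi gPhi xstar (x1 1)" .
    then have "0 \<le> sqrt (2 * bregman Phi gPhi xstar (x1 1))" by simp
    also have "\<dots> \<le> R1" using R1_bound one by blast
    finally have R1: "0 \<le> R1" .
    have gB: "norm (gf i (x1 i)) \<le> B" if "i \<in> {1..m}" for i
      unfolding B_def using that by (intro Max_ge) auto
    have B: "0 \<le> B" using gB[OF one] norm_ge_zero[of "gf 1 (x1 1)"] by linarith
    have schedule: "clipping_schedule \<kappa> \<mu> \<gamma> p Q alpha lam"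
      using L R1 A_pos B mu_pos gamma_gt p_gt kappa_ge
      by unfold_locales (auto simp: Q_def alpha_def lam_def)
    then interpret clipping_schedule \<kappa> \<mu> \<gamma> p Q alpha lam .

    let ?U = "\<lambda>i t. vcond_exp M (filt M G m (t - 1)) (\<lambda>\<eta>. clip (lam t) (G i t \<eta>))"
    have "AE \<omega> in M. norm (gf i (x i t \<omega>)) \<le> lam t / 2 \<longrightarrow>
        norm (?U i t \<omega> - gf i (x i t \<omega>)) \<le> 2 * \<sigma> powr p * lam t powr (1 - p) \<and>
        real_cond_exp M (filt M G m (t - 1)) (\<lambda>\<eta>. (norm (clip (lam t) (G i t \<eta>) - ?U i t \<eta>))\<^sup>2) \<omega>
          \<le> 24 * \<sigma> powr p * lam t powr (2 - p)"
      if it: "i \<in> {1..m}" "t \<in> {1..T}" for i t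
    proof (rule clipped_cond_exp_bounds[OF M_prob])
      show sub: "subalgebra M (filt M G m (t - 1))"
        using it G_meas by (intro subalgebra_filt) auto
      show "(\<lambda>\<omega>. gf i (x i t \<omega>)) \<in> borel_measurable (filt M G m (t - 1))"
      proof (rule Lipschitz_comp_measurable[where g = "gf i" and x = "x i t" and X = X, OF L])
        show "norm (gf i u - gf i v) \<le> L * norm (u - v)" if "u \<in> X" "v \<in> X" for u v
          using A2 it that by blast
        show "x i t \<in> borel_measurable (filt M G m (t - 1))" using x_adapted it by blast
        show "x i t \<omega> \<in> X" if "\<omega> \<in> space (filt M G m (t - 1))" for \<omega>
          using x_X[of i t \<omega>] it that sub by (auto simp: subalgebra_def)
      qed
      show "integrable M (G i t)" using G_int it by (intro integrable_vec) blast
      show "0 < lam t" using lam_ge(1)[of t] it by simp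
    qed (use it A1_unbiased A1_moment p_gt p_le in auto)
    then have "AE \<omega> in M. \<forall>i\<in>{1..m}. \<forall>t\<in>{1..T}. norm (gf i (x i t \<omega>)) \<le> lam t / 2 \<longrightarrow>
        norm (?U i t \<omega> - gf i (x i t \<omega>)) \<le> 2 * \<sigma> powr p * lam t powr (1 - p) \<and>
        real_cond_exp M (filt M G m (t - 1)) (\<lambda>\<eta>. (norm (clip (lam t) (G i t \<eta>) - ?U i t \<eta>))\<^sup>2) \<omega>
          \<le> 24 * \<sigma> powr p * lam t powr (2 - p)"
      by (intro AE_finite_allI) auto
    with AE_space show ?thesis
    proof eventually_elim
      case (elim \<omega>)
      note \<omega> = elim(1) and noise = elim(2)[rule_format]
      show ?case
      proof (intro impI ballI)
        fix K l S
        assume event: "event_E M G Phi gPhi f gf x xstar m T L alpha lam A \<delta> \<omega>"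
          and KS: "K \<in> {1..T}" "S \<in> {1..K}" and l: "l \<in> {1..m}"
        interpret fedsmd_path \<kappa> \<mu> \<gamma> p Q alpha lam m P Tc T L R1 A \<delta> \<sigma> B
          "\<lambda>i t. x i t \<omega>" "\<lambda>i t. y i t \<omega>" "\<lambda>i t. gf i (x i t \<omega>)"
          "\<lambda>i t. theta_b M G m lam gf x i t \<omega>" xstar
          "\<lambda>l t. (\<Sum>i=1..m. f i (x l t \<omega>)) - (\<Sum>i=1..m. f i xstar)"
          "\<lambda>i t. bregman Phi gPhi xstar (x i t \<omega>)"
          "\<lambda>i t. real_cond_exp M (filt M G m (t - 1)) (\<lambda>\<eta>. (norm (theta_u M G m lam i t \<eta>))\<^sup>2) \<omega>"
          "\<lambda>t. Vt Phi gPhi x xstar m A t \<omega>"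
        proof (unfold_locales, goal_cases)
          case 11 show ?case by (simp add: Vt_def)
        next
          case (12 i t) then show ?case using bregman_ge[OF xstar_X x_X[OF _ _ \<omega>]] by blast
        next
          case (13 i) then show ?case using R1_bound x_init \<omega> by simp
        next
          case (14 i) then show ?case using gB x_init \<omega> by simp
        next
          case (15 i t)
          then have "x i t \<omega> \<in> X" "x i 1 \<omega> \<in> X" using x_X[OF _ _ \<omega>] by auto
          then show ?case using A2 15 by blast
        next
          case (16 i t)
          have xX: "x i t \<omega> \<in> X" using x_X[OF _ _ \<omega>] 16 by auto
          \<comment> \<open>The competitor in the minimisation is the current iterate, whose
            divergence from itself is 0.\<close>
          have opt: "y i (t + 1) \<omega> \<in> X" "clip (lam t) (G i t \<omega>) \<bullet> y i (t + 1) \<omega>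
                   + 1 / alpha t * bregman Phi gPhi (y i (t + 1) \<omega>) (x i t \<omega>)
                 \<le> clip (lam t) (G i t \<omega>) \<bullet> x i t \<omega> + 1 / alpha t * bregman Phi gPhi (x i t \<omega>) (x i t \<omega>)"
            using y_step 16 \<omega> xX by blast+
          have "norm (y i (t + 1) \<omega> - x i t \<omega>) \<le> 2 * alpha t * norm (clip (lam t) (G i t \<omega>))"
            by (rule norm_step_le[OF 16(3) opt(2) bregman_ge[OF opt(1) xX]])
          also have "\<dots> \<le> 2 * alpha t * lam t"
            using 16 lam_ge(1)[of t] by (intro mult_left_mono norm_clip_le) auto
          finally show ?case .
        next
          case (17 i t) then show ?case using x_step \<omega> by blast
        next
          case (18 i t) then show ?case using xstar_min x_X[OF _ _ \<omega>] by auto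
        next
          case (19 i t) then show ?case using noise[of i t] by (simp add: theta_b_def)
        next
          case (20 i t) then show ?case using noise[of i t] by (simp add: theta_u_def)
        next
          case (21 l S) then show ?case using event unfolding event_E_def Let_def by blast
        qed (use m_pos P_pos T_def L B A_pos delta_pos delta_lt Q_def A_eq in auto)
        show "(\<Sum>t=1..S. alpha t * ((\<Sum>i=1..m. f i (x l t \<omega>)) - (\<Sum>i=1..m. f i xstar)))
            + (\<Sum>i=1..m. bregman Phi gPhi xstar (x i (S + 1) \<omega>)) \<le> (real m)\<^sup>2 * (R1 + 10 * A)\<^sup>2"
          using KS l by (intro path_bound) auto
      qed
    qed
  qed
qed

end
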